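(* Let $G$ be a connected finite simple graph with at least two vertices, let $k\geq 3$ be an integer with $k\neq 4$, and let $f\colon G\to C_k$ be a graph homomorphism. If the digraph $\overrightarrow{G}_f$ contains a directed cycle, then the connected component $\operatorname{Conn}(\operatorname{Hom}(G,C_k),f)$ is contractible. Otherwise, $\operatorname{Conn}(\operatorname{Hom}(G,C_k),f)$ is homotopy equivalent to a circle.
   Context: Graphs are finite, undirected and simple. A graph homomorphism $G\to H$ is a function $V(G)\to V(H)$ preserving adjacency. For $k\ge 3$, $C_k$ is the cycle graph with vertex set $\mathbb{Z}/k\mathbb{Z}$, in which $x,y$ are adjacent if and only if $y-x\in\{\pm[1]_k\}$, where $[m]_k$ denotes the class of $m$ in $\mathbb{Z}/k\mathbb{Z}$. For a homomorphism $f\colon G\to C_k$, $\overrightarrow{G}_f$ is the digraph with vertex set $V(G)$ and arc set $\{(u,v)\in V(G)^2\mid uv\in E(G),\ f(v)-f(u)=[1]_k\}$ (an orientation of $G$). A directed cycle in a digraph is a sequence $(v_0,v_1,\dots,v_\ell=v_0)$, $\ell\geq 1$, with $v_0,\dots,v_{\ell-1}$ distinct and each $(v_{i-1},v_i)$ an arc. For graphs $G,H$, the Hom complex $\operatorname{Hom}(G,H)$ is the following polyhedral complex (regarded as a topological space): its cells are indexed by the functions $\eta$ assigning to each $v\in V(G)$ a nonempty subset $\eta(v)\subseteq V(H)$ such that whenever $uv\in E(G)$, every element of $\eta(u)$ is adjacent in $H$ to every element of $\eta(v)$; the cell of $\eta$ is the product of simplices $\prod_{v\in V(G)}\Delta^{\eta(v)}$,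 viewed inside $\prod_{v\in V(G)}\Delta^{V(H)}$, where $\Delta^{S}$ denotes the simplex with vertex set $S$. Its vertices are the homomorphisms $G\to H$, and two homomorphisms are joined by an edge if and only if they differ at exactly one vertex of $G$. For a space $X$ and $a\in X$, $\operatorname{Conn}(X,a)$ is the connected component of $X$ containing $a$. *)

theory Defs
  imports
    "HOL-Analysis.Analysis"
    "HOL-Number_Theory.Cong"
    "Graph_Theory.Digraph_Component"
begin

(* A finite simple graph is a "pair_graph": a finite, symmetric, loopfree digraph without
   parallel arcs, in which each undirected edge uv occurs as the two arcs (u,v) and (v,u). *)

definition graph_homs :: "'a pair_pre_digraph \<Rightarrow> 'b pair_pre_digraph \<Rightarrow> ('a \<Rightarrow> 'b) set" where
  "graph_homs G H =
     {f \<in> pverts G \<rightarrow>\<^sub>E pverts H. \<forall>u v. (u, v) \<in> parcs G \<longrightarrow> (f u, f v) \<in> parcs H}"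

(* The class [m]_k in Z/kZ is represented by its residue in {0..<k}; equality of classes
   becomes congruence modulo k. *)

definition cycle_graph :: "nat \<Rightarrow> int pair_pre_digraph" where
  "cycle_graph k =
     \<lparr> pverts = {0..<int k},
       parcs = {(x, y). x \<in> {0..<int k} \<and> y \<in> {0..<int k} \<and>
                 ([y - x = 1] (mod int k) \<or> [y - x = - 1] (mod int k))} \<rparr>"

definition hom_orientation ::
  "nat \<Rightarrow> 'a pair_pre_digraph \<Rightarrow> ('a \<Rightarrow> int) \<Rightarrow> 'a pair_pre_digraph" where
  "hom_orientation k G f =
     \<lparr> pverts = pverts G,
       parcs = {(u, v). (u, v) \<in> parcs G \<and> [f v - f u = 1] (mod int k)} \<rparr>"

(* Arc_Walk's "cycle" is a closed walk of length \<ge> 1 whose vertices other than the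
   first are distinct; it is stored as its list of arcs. *)

definition has_directed_cycle :: "'a pair_pre_digraph \<Rightarrow> bool" where
  "has_directed_cycle D \<longleftrightarrow> (\<exists>p. pre_digraph.cycle (with_proj D) p)"

(* The face with vertex set S of the simplex with vertex set W, in barycentric coordinates;
   W is meant to be finite and S \<subseteq> W. *)

definition simplex_face :: "'b set \<Rightarrow> 'b set \<Rightarrow> ('b \<Rightarrow> real) set" where
  "simplex_face W S = {t \<in> W \<rightarrow>\<^sub>E {0..}. (\<forall>w \<in> W - S. t w = 0) \<and> sum t W = 1}"

definition multihoms :: "'a pair_pre_digraph \<Rightarrow> 'b pair_pre_digraph \<Rightarrow> ('a \<Rightarrow> 'b set) set" where
  "multihoms G H =
     {\<eta> \<in> pverts G \<rightarrow>\<^sub>E (Pow (pverts H) - {{}}).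
        \<forall>u v. (u, v) \<in> parcs G \<longrightarrow> \<eta> u \<times> \<eta> v \<subseteq> parcs H}"

definition hom_cell ::
  "'a pair_pre_digraph \<Rightarrow> 'b pair_pre_digraph \<Rightarrow> ('a \<Rightarrow> 'b set) \<Rightarrow> ('a \<Rightarrow> 'b \<Rightarrow> real) set" where
  "hom_cell G H \<eta> = (\<Pi>\<^sub>E v \<in> pverts G. simplex_face (pverts H) (\<eta> v))"

(* For finite G and H there are finitely many cells, all of them compact, so the topology of
   the polyhedral complex is the subspace topology. *)

definition hom_complex ::
  "'a pair_pre_digraph \<Rightarrow> 'b pair_pre_digraph \<Rightarrow> ('a \<Rightarrow> 'b \<Rightarrow> real) topology" where
  "hom_complex G H =
     subtopology (product_topology (\<lambda>_. powertop_real (pverts H)) (pverts G))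
       (\<Union>\<eta> \<in> multihoms G H. hom_cell G H \<eta>)"

(* The vertex of the complex given by a homomorphism f, i.e. the cell of v \<mapsto> {f v}. *)

definition hom_vertex ::
  "'a pair_pre_digraph \<Rightarrow> 'b pair_pre_digraph \<Rightarrow> ('a \<Rightarrow> 'b) \<Rightarrow> 'a \<Rightarrow> 'b \<Rightarrow> real" where
  "hom_vertex G H f = (\<lambda>v \<in> pverts G. \<lambda>w \<in> pverts H. if w = f v then 1 else 0)"

definition Conn :: "'a topology \<Rightarrow> 'a \<Rightarrow> 'a topology" where
  "Conn X a = subtopology X (connected_component_of_set X a)"

lemma pair_graph_cycle_graph:
  assumes "k \<ge> 3"
  shows "pair_graph (cycle_graph k)"
proof
  show "finite (parcs (cycle_graph k))"
    by (rule finite_subset[of _ "{0..<int k} \<times> {0..<int k}"]) (auto simp: cycle_graph_def)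
  have "[y - x = c] (mod int k) \<Longrightarrow> [x - y = - c] (mod int k)" for x y c
    using cong_minus_minus_iff[of "y - x" c "int k"] by simp
  from this[of _ _ 1] this[of _ _ "- 1"]
  show "symmetric (with_proj (cycle_graph k))"
    unfolding symmetric_def by (auto simp: cycle_graph_def intro!: symI)
  have "\<not> [0 = 1] (mod int k)" "\<not> [0 = - 1] (mod int k)"
    using assms by (auto simp: cong_iff_dvd_diff)
  then show "fst e \<noteq> snd e" if "e \<in> parcs (cycle_graph k)" for e
    using that by (auto simp: cycle_graph_def)
qed (auto simp: cycle_graph_def)

lemma singleton_multihom:
  assumes "pair_wf_digraph G" "f \<in> graph_homs G H"
  shows "(\<lambda>v \<in> pverts G. {f v}) \<in> multihoms G H"
  using assms by (auto simp: graph_homs_def multihoms_def pair_wf_digraph_def)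

lemma hom_cell_singleton:
  assumes "finite (pverts H)" "f \<in> graph_homs G H"
  shows "hom_cell G H (\<lambda>v \<in> pverts G. {f v}) = {hom_vertex G H f}"
proof -
  have "simplex_face (pverts H) {f v} = {\<lambda>w \<in> pverts H. if w = f v then 1 else 0}"
    if "v \<in> pverts G" for v
  proof -
    have fv: "f v \<in> pverts H"
      using assms(2) that by (auto simp: graph_homs_def)
    have "t = (\<lambda>w \<in> pverts H. if w = f v then 1 else 0)"
      if t: "t \<in> simplex_face (pverts H) {f v}" for t
    proof -
      have "sum t (pverts H) = t (f v)"
        using t fv assms(1) by (subst sum.remove[of _ "f v"]) (auto simp: simplex_face_def)
      then show ?thesis
        using t by (auto simp: simplex_face_def fun_eq_iff PiE_def extensional_def)
    qed
    moreover have "(\<lambda>w \<in> pverts H. if w = f v then 1 else 0) \<in> simplex_face (pverts H) {f v}"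
      using fv assms(1) by (auto simp: simplex_face_def cong: sum.cong)
    ultimately show ?thesis by blast
  qed
  then show "hom_cell G H (\<lambda>v \<in> pverts G. {f v}) = {hom_vertex G H f}"
    by (auto simp: hom_cell_def hom_vertex_def PiE_iff extensional_def fun_eq_iff)
qed

lemma hom_vertex_in_hom_complex:
  assumes "pair_wf_digraph G" "finite (pverts H)" "f \<in> graph_homs G H"
  shows "hom_vertex G H f \<in> topspace (hom_complex G H)"
  using singleton_multihom[OF assms(1,3)] hom_cell_singleton[OF assms(2,3)]
  by (auto simp: hom_complex_def hom_vertex_def)

end

(* Lift a homomorphism g near f to h : V -> Z by g = f + 2 h, and likewise a point of the Hom complex
   to h : V -> R.  As k is not 4, at most one end of each edge moves at a time, so the lifts
   are exactly the h for which (h u, h v) lies on a fixed staircase curve in R^2 for every arc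
   u -> v of the orientation.  The staircase is a chain for the product order, so the lifts form a
   closed sublattice of R^V, invariant under integer translations; two lifts of the same point
   differ by a constant integer m with k | 2 m.  A component of the Hom complex is the image of a
   path component of the space of lifts, because that image and its complement are unions of cells.

   On a directed cycle h decreases and is therefore constant with integer values.  Then the path
   component of 0 is a compact lattice that maps homeomorphically onto the component of f, and
   h |-> max h (p t), for a path p from its least to its greatest element, contracts it.

   If the orientation is acyclic, raising the vertices one after another in topological order gives
   a path "line" of lifts with line (t + 1) = line t + 1, and h |-> max h (line (h v + c)), with c
   running from a large negative to a large positive number, deforms the space of lifts onto this
   line.  Everything commutes with integer translations, so the component is homotopy
   equivalent to a quotient of R by a group of translations. *)
theory Submission
  imports Defs
begin

section \<open>Interpolation and the staircase\<close>

definition interp :: "(int \<Rightarrow> real) \<Rightarrow> real \<Rightarrow> real" where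
  "interp c x = c \<lfloor>x\<rfloor> + (c (\<lfloor>x\<rfloor> + 1) - c \<lfloor>x\<rfloor>) * (x - of_int \<lfloor>x\<rfloor>)"

text \<open>The formula of a segment also holds at its right end point, so at an integer either
  adjacent segment may be used.\<close>

lemma interp_eq:
  assumes "of_int n \<le> x" "x \<le> of_int n + 1"
  shows "interp c x = c n + (c (n + 1) - c n) * (x - of_int n)"
proof (cases "x = of_int n + 1")
  case True
  then have "\<lfloor>x\<rfloor> = n + 1" by linarith
  with True show ?thesis by (simp add: interp_def)
next
  case False
  with assms have "\<lfloor>x\<rfloor> = n" by linarith
  then show ?thesis by (simp add: interp_def)
qed

text \<open>Around x, with n the floor of x, the function is c n plus multiples of the positive and
  the negative part of y - n; this expression covers both segments that meet at n and is visibly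
  continuous.\<close>

lemma continuous_on_interp: "continuous_on UNIV (interp c)"
proof (rule continuous_at_imp_continuous_on, rule ballI)
  fix x :: real
  define n where "n = \<lfloor>x\<rfloor>"
  define g where "g y = c n + (c (n + 1) - c n) * max (y - of_int n) 0
                      + (c n - c (n - 1)) * min (y - of_int n) 0" for y
  have eq: "g y = interp c y" if "y \<in> {of_int n - 1<..<of_int n + 1}" for y
  proof (cases "y \<ge> of_int n")
    case True
    then show ?thesis
      using that by (subst interp_eq[of n]) (auto simp: g_def)
  next
    case False
    then show ?thesis
      using that by (subst interp_eq[of "n - 1"]) (auto simp: g_def algebra_simps)
  qed
  have "isCont g x"
    unfolding g_def by (intro continuous_intros)
  moreover have "\<forall>\<^sub>F y in nhds x. g y = interp c y"
    by (rule eventually_nhds_in_open[THEN eventually_mono, of "{of_int n - 1<..<of_int n + 1}"])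
       (use eq in \<open>auto simp: n_def, linarith+\<close>)
  ultimately show "isCont (interp c) x"
    by (simp add: isCont_cong)
qed

lemma interp_add_of_int: "interp c (x + of_int m) = interp (\<lambda>n. c (n + m)) x"
  by (simp add: interp_def algebra_simps)

lemma interp_linear: "interp (\<lambda>n. a * c n - of_int n) x = a * interp c x - x"
  by (simp add: interp_def algebra_simps)

lemma interp_add_const: "interp (\<lambda>n. c n + a) x = interp c x + a"
  by (simp add: interp_def algebra_simps)

text \<open>The value is a convex combination of two consecutive terms of the sequence.\<close>

lemma interp_between:
  assumes "\<And>n. a \<le> c n" "\<And>n. c n \<le> b"
  shows "a \<le> interp c x" "interp c x \<le> b"
proof -
  define s where "s = x - of_int \<lfloor>x\<rfloor>"
  have s: "0 \<le> s" "0 \<le> 1 - s" unfolding s_def by linarith+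
  have eq: "interp c x = (1 - s) * c \<lfloor>x\<rfloor> + s * c (\<lfloor>x\<rfloor> + 1)"
    by (simp add: interp_def s_def algebra_simps)
  have "(1 - s) * a + s * a \<le> interp c x" "interp c x \<le> (1 - s) * b + s * b"
    unfolding eq using s assms by (auto intro!: add_mono mult_left_mono)
  then show "a \<le> interp c x" "interp c x \<le> b" by (simp_all add: algebra_simps)
qed

section \<open>The staircase curve as a closed sublattice of the plane\<close>

text \<open>The curve \<open>stair\<close> runs through the points \<open>(n, n)\<close>, \<open>(n + 1, n)\<close>, \<open>(n + 1, n + 1)\<close> for
  integers \<open>n\<close>; it is a chain for the product order.\<close>

definition stair :: "real \<Rightarrow> real \<Rightarrow> bool" where
  "stair x y \<longleftrightarrow> \<lceil>y\<rceil> \<le> \<lfloor>x\<rfloor> \<and> \<lceil>x\<rceil> \<le> \<lfloor>y\<rfloor> + 1"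

lemma stair_bounds:
  assumes "stair x y" shows "y \<le> x" "x \<le> y + 1"
  using assms unfolding stair_def by linarith+

lemma stair_add_of_int: "stair x y \<Longrightarrow> stair (x + of_int m) (y + of_int m)"
  unfolding stair_def by simp

text \<open>The inequality fails exactly when some integer n satisfies n < y and x < n + 1.\<close>

lemma ceiling_le_floor_iff:
  "\<lceil>y\<rceil> \<le> \<lfloor>x\<rfloor> \<longleftrightarrow> (\<forall>n. y \<le> of_int n \<or> of_int n + 1 \<le> x)" for x y :: real
proof -
  have "y \<le> of_int n \<or> of_int n + 1 \<le> x \<longleftrightarrow> \<lceil>y\<rceil> \<le> n \<or> n + 1 \<le> \<lfloor>x\<rfloor>" for n
    by (simp add: ceiling_le_iff le_floor_iff)
  then show ?thesis
    by (metis add1_zle_eq linorder_not_less order.trans order_refl)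
qed

text \<open>In this form every condition is, for fixed n, a disjunction of an upper bound on one
  coordinate and a lower bound on the other. Such a condition is closed and survives coordinatewise
  max and min, which yields \<open>stair_max\<close>, \<open>stair_min\<close> and
  \<open>closedin_lifts\<close>.\<close>

lemma stair_iff:
  "stair x y \<longleftrightarrow> (\<forall>n. y \<le> of_int n \<or> of_int n + 1 \<le> x) \<and> (\<forall>n. x \<le> of_int n \<or> of_int n \<le> y)"
proof -
  have "\<lceil>x\<rceil> \<le> \<lfloor>y\<rfloor> + 1 \<longleftrightarrow> \<lceil>x\<rceil> \<le> \<lfloor>y + 1\<rfloor>" by simp
  also have "\<dots> \<longleftrightarrow> (\<forall>n. x \<le> of_int n \<or> of_int n + 1 \<le> y + 1)"
    by (rule ceiling_le_floor_iff)
  also have "\<dots> \<longleftrightarrow> (\<forall>n. x \<le> of_int n \<or> of_int n \<le> y)"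
    by simp
  finally show ?thesis
    by (simp only: stair_def ceiling_le_floor_iff[of y x])
qed

lemma stair_of_int:
  "of_int n \<le> x \<Longrightarrow> x \<le> of_int n + 1 \<Longrightarrow> stair x (of_int n)"
  "of_int n \<le> x \<Longrightarrow> x \<le> of_int n + 1 \<Longrightarrow> stair (of_int n + 1) x"
  unfolding stair_def by (simp_all add: le_floor_iff ceiling_le_iff)

lemma stair_max: "stair x y \<Longrightarrow> stair x' y' \<Longrightarrow> stair (max x x') (max y y')"
  unfolding stair_iff le_max_iff_disj max.bounded_iff by blast

lemma stair_min: "stair x y \<Longrightarrow> stair x' y' \<Longrightarrow> stair (min x x') (min y y')"
  unfolding stair_iff min_le_iff_disj min.bounded_iff by blast

section \<open>A step function that climbs in unit time and then rests\<close>

text \<open>\<open>step_fun n\<close> climbs from \<open>j\<close> to \<open>j + 1\<close> on \<open>{n * j..n * j + 1}\<close> and is constant up to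
  \<open>n * (j + 1)\<close>.\<close>

definition step_fun :: "nat \<Rightarrow> real \<Rightarrow> real" where
  "step_fun n = interp (\<lambda>j. of_int ((j + int n - 1) div int n))"

lemma step_fun_add:
  assumes "n > 0" shows "step_fun n (x + of_int (m * int n)) = step_fun n x + of_int m"
proof -
  have "(j + m * int n + int n - 1) div int n = (j + int n - 1) div int n + m" for j
    using assms div_mult_self1[of "int n" "j + int n - 1" m] by (simp add: algebra_simps)
  then show ?thesis
    unfolding step_fun_def interp_add_of_int using interp_add_const by (simp add: algebra_simps)
qed

text \<open>At an integer j the value is the ceiling of j / n, where both bounds hold. They extend
  to all reals because n * \<open>step_fun n x\<close> - x is again an interpolation, by
  \<open>interp_linear\<close>.\<close>

lemma step_fun_bounds:
  assumes "n > 0" shows "x \<le> n * step_fun n x" "n * step_fun n x \<le> x + n"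
proof -
  have *: "0 \<le> int n * ((j + int n - 1) div int n) - j \<and>
      int n * ((j + int n - 1) div int n) - j \<le> int n" for j
  proof -
    have "int n * ((j + int n - 1) div int n) = j + int n - 1 - (j + int n - 1) mod int n"
      by (simp add: minus_mod_eq_mult_div)
    moreover have "0 \<le> (j + int n - 1) mod int n" "(j + int n - 1) mod int n < int n"
      using assms by simp_all
    ultimately show ?thesis by linarith
  qed
  have **: "0 \<le> real n * of_int ((j + int n - 1) div int n) - of_int j"
      "real n * of_int ((j + int n - 1) div int n) - of_int j \<le> real n" for j
    using *[of j]
    by (metis of_int_0_le_iff of_int_diff of_int_mult of_int_of_nat_eq,
        metis of_int_le_iff of_int_diff of_int_mult of_int_of_nat_eq)
  from interp_between[of 0 "\<lambda>j. real n * of_int ((j + int n - 1) div int n) - of_int j" "real n" x, OF **]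
  show "x \<le> n * step_fun n x" "n * step_fun n x \<le> x + n"
    unfolding interp_linear step_fun_def by linarith+
qed

text \<open>Climbs start at multiples of n and last for one unit. As 0 < d < n, the arguments x and
  x - d are never inside climbs at the same time, and the lagging one completes its climb before the
  leading one begins the next.\<close>

lemma stair_step_fun:
  assumes "0 < d" "d < n"
  shows "stair (step_fun n x) (step_fun n (x - real d))"
proof -
  define j where "j = \<lfloor>x\<rfloor>"
  define s where "s = x - of_int j"
  have s: "0 \<le> s" "s < 1" unfolding s_def j_def by linarith+
  define N where "N = int n"
  define D where "D = int d"
  define q where "q = j div N"
  define r where "r = j mod N"
  have j: "j = N * q + r" by (simp add: q_def r_def)
  have r: "0 \<le> r" "r < N" using assms by (auto simp: r_def N_def)
  have D: "0 < D" "D < N" using assms by (auto simp: D_def N_def)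
  \<comment> \<open>This quotient is the ceiling of i / N, the term at i of the sequence that is
    interpolated.\<close>
  have c: "(i + N - 1) div N = m" if "N * m - N < i" "i \<le> N * m" for i m
    by (rule int_div_pos_eq[of _ _ _ "i + N - 1 - N * m"]) (use that in auto)
  have fx: "step_fun n x = of_int ((j + N - 1) div N) +
      (of_int ((j + 1 + N - 1) div N) - of_int ((j + N - 1) div N)) * s"
    unfolding step_fun_def by (subst interp_eq[of j]) (use s in \<open>auto simp: s_def N_def\<close>)
  have fy: "step_fun n (x - real d) = of_int ((j - D + N - 1) div N) +
      (of_int ((j - D + 1 + N - 1) div N) - of_int ((j - D + N - 1) div N)) * s"
    unfolding step_fun_def by (subst interp_eq[of "j - D"]) (use s in \<open>auto simp: s_def N_def D_def algebra_simps\<close>)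
  \<comment> \<open>The leading argument climbs for r = 0 and the lagging one for r = D; otherwise
    both rest, one apart for r < D and level for r > D.\<close>
  consider "r = 0" | "r = D" | "0 < r" "r < D" | "D < r" using r by linarith
  then show ?thesis
  proof cases
    case 1
    have "(j + N - 1) div N = q" "(j + 1 + N - 1) div N = q + 1" "(j - D + N - 1) div N = q" "(j - D + 1 + N - 1) div N = q"
      by (rule c; use 1 D in \<open>simp add: j algebra_simps\<close>)+
    then show ?thesis unfolding fx fy stair_def using s by simp linarith
  next
    case 2
    have "(j + N - 1) div N = q + 1" "(j + 1 + N - 1) div N = q + 1" "(j - D + N - 1) div N = q" "(j - D + 1 + N - 1) div N = q + 1"
      by (rule c; use 2 D in \<open>simp add: j algebra_simps\<close>)+
    then show ?thesis unfolding fx fy stair_def using s by simp linarith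
  next
    case 3
    have "(j + N - 1) div N = q + 1" "(j + 1 + N - 1) div N = q + 1" "(j - D + N - 1) div N = q" "(j - D + 1 + N - 1) div N = q"
      by (rule c; use 3 D r in \<open>simp add: j algebra_simps\<close>)+
    then show ?thesis unfolding fx fy stair_def using s by simp
  next
    case 4
    have "(j + N - 1) div N = q + 1" "(j + 1 + N - 1) div N = q + 1" "(j - D + N - 1) div N = q + 1" "(j - D + 1 + N - 1) div N = q + 1"
      by (rule c; use 4 D r in \<open>simp add: j algebra_simps\<close>)+
    then show ?thesis unfolding fx fy stair_def using s by simp
  qed
qed

section \<open>Barycentric coordinates of a point that moves in steps of two around the
  cycle\<close>

text \<open>The barycentric coordinate at \<open>w\<close> of the point at position \<open>a + 2 * x\<close> on the circle of
  length \<open>k\<close>, on the segment between the vertices \<open>a + 2 * \<lfloor>x\<rfloor>\<close> and \<open>a + 2 * \<lfloor>x\<rfloor> + 2\<close>.\<close>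

definition weight :: "nat \<Rightarrow> int \<Rightarrow> real \<Rightarrow> int \<Rightarrow> real" where
  "weight k a x w = interp (\<lambda>n. of_bool [a + 2 * n = w] (mod int k)) x"

lemma continuous_on_weight: "continuous_on UNIV (\<lambda>x. weight k a x w)"
  unfolding weight_def by (rule continuous_on_interp)

text \<open>That k does not divide 4 is where k = 4 is excluded: it makes b + 1 the only common
  neighbour of b and b + 2 in the cycle.\<close>

lemma not_dvd_2_4:
  assumes "k \<ge> 3" "k \<noteq> 4"
  shows "\<not> int k dvd 1" "\<not> int k dvd 2" "\<not> int k dvd 4"
proof -
  show "\<not> int k dvd 1" "\<not> int k dvd 2" using assms by (auto dest: zdvd_imp_le)
  show "\<not> int k dvd 4"
  proof
    assume *: "int k dvd 4"
    then have "int k \<le> 4" by (auto dest: zdvd_imp_le)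
    with assms have "k = 3" by linarith
    with * show False by simp
  qed
qed

lemma weight_eq:
  assumes "k \<ge> 3" "of_int n \<le> x" "x \<le> of_int n + 1"
  shows "weight k a x w = (if [a + 2 * n = w] (mod int k) then of_int n + 1 - x
            else if [a + 2 * n + 2 = w] (mod int k) then x - of_int n else 0)"
proof -
  have "\<not> int k dvd 2" using assms(1) by (auto dest: zdvd_imp_le)
  then have "\<not> ([a + 2 * n = w] (mod int k) \<and> [a + 2 * n + 2 = w] (mod int k))"
    using dvd_diff[of "int k" "a + 2 * n + 2 - w" "a + 2 * n - w"]
    by (auto simp: cong_iff_dvd_diff)
  then show ?thesis
    unfolding weight_def by (subst interp_eq[OF assms(2,3)]) (auto simp: algebra_simps)
qed

lemma weight_add_of_int:
  assumes "int k dvd 2 * m" shows "weight k a (x + of_int m) w = weight k a x w"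
proof -
  have "[a + 2 * (n + m) = w] (mod int k) \<longleftrightarrow> [a + 2 * n = w] (mod int k)" for n
  proof -
    have "a + 2 * (n + m) - w = (a + 2 * n - w) + 2 * m" by simp
    then show ?thesis
      using assms by (metis cong_iff_dvd_diff dvd_add_left_iff)
  qed
  then show ?thesis by (simp add: weight_def interp_add_of_int)
qed

lemma weight_nonneg: "0 \<le> weight k a x w"
  unfolding weight_def by (rule interp_between) auto

lemma cong_residue_iff:
  assumes "w \<in> {0..<int k}" shows "[y = w] (mod int k) \<longleftrightarrow> w = y mod int k"
  using assms by (auto simp: cong_def)

lemma sum_weight:
  assumes "k \<ge> 3" shows "(\<Sum>w\<in>{0..<int k}. weight k a x w) = 1"
proof -
  define n where "n = \<lfloor>x\<rfloor>"
  have n: "of_int n \<le> x" "x \<le> of_int n + 1" unfolding n_def by linarith+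
  have *: "weight k a x w = (of_int n + 1 - x) * of_bool (w = (a + 2 * n) mod int k)
      + (x - of_int n) * of_bool (w = (a + 2 * n + 2) mod int k)" if "w \<in> {0..<int k}" for w
    using that unfolding weight_def
    by (subst interp_eq[OF n]) (simp add: cong_residue_iff algebra_simps)
  have "(\<Sum>w\<in>{0..<int k}. of_bool (w = y mod int k)) = (1::real)" for y
    using assms by simp
  then show ?thesis
    by (simp add: * sum.distrib flip: sum_distrib_left)
qed

lemma weight_residue_pos:
  assumes "k \<ge> 3"
  shows "weight k a x ((a + 2 * \<lfloor>x\<rfloor>) mod int k) > 0"
    and "x \<noteq> of_int \<lfloor>x\<rfloor> \<Longrightarrow> weight k a x ((a + 2 * \<lfloor>x\<rfloor> + 2) mod int k) > 0"
proof -
  have n: "of_int \<lfloor>x\<rfloor> \<le> x" "x \<le> of_int \<lfloor>x\<rfloor> + 1" "x < of_int \<lfloor>x\<rfloor> + 1" by linarith+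
  have "\<not> int k dvd 2" using assms(1) by (auto dest: zdvd_imp_le)
  then have *: "\<not> [a + 2 * \<lfloor>x\<rfloor> = a + 2 * \<lfloor>x\<rfloor> + 2] (mod int k)"
    by (simp add: cong_iff_dvd_diff)
  show "weight k a x ((a + 2 * \<lfloor>x\<rfloor>) mod int k) > 0"
    using n by (simp add: weight_eq[OF assms n(1,2)])
  show "weight k a x ((a + 2 * \<lfloor>x\<rfloor> + 2) mod int k) > 0" if "x \<noteq> of_int \<lfloor>x\<rfloor>"
    using n order.not_eq_order_implies_strict[OF that[symmetric] n(1)] * by (simp add: weight_eq[OF assms n(1,2)])
qed

lemma weight_support:
  assumes "k \<ge> 3" "weight k a x w \<noteq> 0"
  shows "[a + 2 * \<lfloor>x\<rfloor> = w] (mod int k) \<or> x \<noteq> of_int \<lfloor>x\<rfloor> \<and> [a + 2 * \<lfloor>x\<rfloor> + 2 = w] (mod int k)"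
proof -
  have n: "of_int \<lfloor>x\<rfloor> \<le> x" "x \<le> of_int \<lfloor>x\<rfloor> + 1" by linarith+
  show ?thesis
    using assms(2) unfolding weight_eq[OF assms(1) n] by (auto split: if_splits)
qed

lemma weight_supported_singleton:
  assumes k: "k \<ge> 3" and 0: "\<And>w. w \<in> {0..<int k} \<Longrightarrow> w \<noteq> b \<Longrightarrow> weight k a x w = 0"
  obtains n where "x = of_int n" "[a + 2 * n = b] (mod int k)"
proof
  have in_range: "y mod int k \<in> {0..<int k}" for y using k by simp
  have b: "(a + 2 * \<lfloor>x\<rfloor>) mod int k = b"
    using 0[OF in_range, of "a + 2 * \<lfloor>x\<rfloor>"] weight_residue_pos(1)[OF k, of a x] by fastforce
  then show "[a + 2 * \<lfloor>x\<rfloor> = b] (mod int k)" by (auto simp: cong_def)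
  show "x = of_int \<lfloor>x\<rfloor>"
  proof (rule ccontr)
    assume "x \<noteq> of_int \<lfloor>x\<rfloor>"
    then have "(a + 2 * \<lfloor>x\<rfloor> + 2) mod int k = b"
      using 0[OF in_range, of "a + 2 * \<lfloor>x\<rfloor> + 2"] weight_residue_pos(2)[OF k, of x a] by fastforce
    with b have "[a + 2 * \<lfloor>x\<rfloor> + 2 = a + 2 * \<lfloor>x\<rfloor>] (mod int k)" by (simp add: cong_def)
    then have "int k dvd 2" by (simp add: cong_iff_dvd_diff)
    then show False using k by (auto dest: zdvd_imp_le)
  qed
qed

text \<open>All residues of positive weight lie in {b, b + 2}. If x were strictly inside the segment
  that starts at b + 2, then b + 4 would also carry weight, and k would divide 4 or 2.\<close>

lemma weight_supported_pair:
  assumes k: "k \<ge> 3" "k \<noteq> 4" and b: "[b' = b + 2] (mod int k)"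
    and 0: "\<And>w. w \<in> {0..<int k} \<Longrightarrow> w \<noteq> b \<Longrightarrow> w \<noteq> b' \<Longrightarrow> weight k a x w = 0"
  obtains n where "of_int n \<le> x" "x \<le> of_int n + 1" "[a + 2 * n = b] (mod int k)"
proof -
  have in_range: "y mod int k \<in> {0..<int k}" for y using k by simp
  have *: "int k dvd y - b \<or> int k dvd y - (b + 2)" if "weight k a x (y mod int k) > 0" for y
  proof -
    have "y mod int k = b \<or> y mod int k = b'"
      using 0[OF in_range, of y] that by fastforce
    then have "[y = b] (mod int k) \<or> [y = b'] (mod int k)" by (auto simp: cong_def)
    with b show ?thesis by (auto simp: cong_iff_dvd_diff[symmetric] intro: cong_trans)
  qed
  have n: "of_int \<lfloor>x\<rfloor> \<le> x" "x \<le> of_int \<lfloor>x\<rfloor> + 1" by linarith+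
  from *[OF weight_residue_pos(1)[OF k(1)]] consider "int k dvd a + 2 * \<lfloor>x\<rfloor> - b"
    | "int k dvd a + 2 * \<lfloor>x\<rfloor> - (b + 2)" by blast
  then show ?thesis
  proof cases
    case 1
    then show ?thesis using that[OF n] by (simp add: cong_iff_dvd_diff)
  next
    case 2
    show ?thesis
    proof (cases "x = of_int \<lfloor>x\<rfloor>")
      case True
      \<comment> \<open>Here x sits at the far end b' of the segment, so the segment starts one unit
        before the floor of x.\<close>
      show ?thesis
        by (rule that[of "\<lfloor>x\<rfloor> - 1"]) (use True 2 in \<open>auto simp: cong_iff_dvd_diff algebra_simps\<close>)
    next
      case False
      from *[OF weight_residue_pos(2)[OF k(1) False]]
      consider "int k dvd a + 2 * \<lfloor>x\<rfloor> + 2 - b" | "int k dvd a + 2 * \<lfloor>x\<rfloor> + 2 - (b + 2)" by blast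
      then show ?thesis
      proof cases
        case 3: 1
        from dvd_diff[OF 3 2] have "int k dvd 4" by simp
        with not_dvd_2_4[OF k] show ?thesis by blast
      next
        case 4: 2
        from dvd_diff[OF 4 2] have "int k dvd 2" by simp
        with not_dvd_2_4[OF k] show ?thesis by blast
      qed
    qed
  qed
qed

text \<open>Equal coordinates put y on the same segment from b to b + 2 as x, and the weight at b
  fixes the position within it. For k = 4 the segments from b to b + 2 and from b + 2 to b have the
  same vertices and could not be told apart.\<close>

lemma weight_eq_imp:
  assumes k: "k \<ge> 3" "k \<noteq> 4"
    and eq: "\<And>w. w \<in> {0..<int k} \<Longrightarrow> weight k a x w = weight k a y w"
  obtains m where "y = x + of_int m" "int k dvd 2 * m"
proof -
  define n where "n = \<lfloor>x\<rfloor>"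
  define n' where "n' = \<lfloor>y\<rfloor>"
  have n: "of_int n \<le> x" "x \<le> of_int n + 1" "x < of_int n + 1" unfolding n_def by linarith+
  have n': "of_int n' \<le> y" "y \<le> of_int n' + 1" "y < of_int n' + 1" unfolding n'_def by linarith+
  define b where "b = (a + 2 * n) mod int k"
  define b' where "b' = (a + 2 * n + 2) mod int k"
  have in_range: "z mod int k \<in> {0..<int k}" for z using k by simp
  have bb': "[b' = b + 2] (mod int k)" by (simp add: b_def b'_def cong_def mod_simps)
  have supp: "weight k a x w = 0" if "w \<in> {0..<int k}" "w \<noteq> b" "w \<noteq> b'" for w
    using weight_support[OF k(1), of a x w] that by (auto simp: n_def b_def b'_def cong_residue_iff)
  obtain l where l: "of_int l \<le> y" "y \<le> of_int l + 1" "[a + 2 * l = b] (mod int k)"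
    using weight_supported_pair[OF k bb', of a y] supp eq by auto
  have "of_int n + 1 - x = weight k a x b"
    using n by (simp add: weight_eq[OF k(1) n(1,2)] b_def)
  also have "\<dots> = weight k a y b" using eq in_range b_def by simp
  also have "\<dots> = of_int l + 1 - y"
    using l by (simp add: weight_eq[OF k(1) l(1,2)])
  finally have "y = x + of_int (l - n)" by simp
  moreover have "[a + 2 * l = a + 2 * n] (mod int k)" using l(3) by (simp add: b_def)
  then have "int k dvd 2 * (l - n)" by (simp add: cong_iff_dvd_diff algebra_simps)
  ultimately show ?thesis by (rule that)
qed

lemma weight_singleton:
  assumes "k \<ge> 3" "[a + 2 * n = b] (mod int k)" "w \<in> {0..<int k}" "b \<in> {0..<int k}"
  shows "weight k a (of_int n) w = of_bool (w = b)"
  using assms weight_eq[OF assms(1), of n "of_int n" a w]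
  by (auto simp: cong_residue_iff)

lemma weight_pair:
  assumes k: "k \<ge> 3" and n: "[a + 2 * n = b] (mod int k)" and b: "[b' = b + 2] (mod int k)"
    and w: "w \<in> {0..<int k}" "b \<in> {0..<int k}" "b' \<in> {0..<int k}" and s: "0 \<le> s" "s \<le> 1"
  shows "weight k a (of_int n + s) w = (if w = b then 1 - s else if w = b' then s else 0)"
proof -
  have "[a + 2 * n = w] (mod int k) \<longleftrightarrow> w = b"
    using w n by (auto simp: cong_residue_iff)
  moreover have "[a + 2 * n + 2 = b'] (mod int k)"
    using cong_trans[OF cong_add[OF n cong_refl[of 2]] cong_sym[OF b]] .
  then have "[a + 2 * n + 2 = w] (mod int k) \<longleftrightarrow> w = b'"
    using w by (auto simp: cong_residue_iff)
  ultimately show ?thesis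
    using s by (subst weight_eq[OF k, of n]) auto
qed

section \<open>Homotopy equivalences between quotients\<close>

lemma homotopic_with_TrueI:
  assumes "continuous_map (prod_topology (top_of_set {0..1::real}) X) Y h"
    and "\<And>x. x \<in> topspace X \<Longrightarrow> h (0, x) = p x" "\<And>x. x \<in> topspace X \<Longrightarrow> h (1, x) = q x"
  shows "homotopic_with (\<lambda>x. True) X Y p q"
proof -
  have "homotopic_with (\<lambda>x. True) X Y p q \<longleftrightarrow>
      (\<exists>h. continuous_map (prod_topology (top_of_set {0..1::real}) X) Y h \<and>
        (\<forall>x \<in> topspace X. h (0, x) = p x) \<and> (\<forall>x \<in> topspace X. h (1, x) = q x) \<and>
        (\<forall>t \<in> {0..1::real}. True))"
    by (rule homotopic_with) simp
  with assms show ?thesis by blast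
qed

text \<open>On the compact set K the map q is a continuous surjection onto a Hausdorff space, hence
  a quotient map, so F restricted to K factors through it. Compatibility carries the factorization
  over to all of A, which itself may be noncompact.\<close>

lemma continuous_map_descends:
  assumes q: "continuous_map A Y q" and K: "compactin A K" "q ` K = topspace Y" and Y: "Hausdorff_space Y"
    and F: "continuous_map A Z F"
    and compat: "\<And>x x'. x \<in> topspace A \<Longrightarrow> x' \<in> topspace A \<Longrightarrow> q x = q x' \<Longrightarrow> F x = F x'"
  shows "\<exists>F'. continuous_map Y Z F' \<and> (\<forall>x \<in> topspace A. F' (q x) = F x)"
proof -
  have KA: "K \<subseteq> topspace A" using K(1) by (simp add: compactin_subspace)
  then have top: "topspace (subtopology A K) = K" by auto
  have qm: "quotient_map (subtopology A K) Y q"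
  proof (rule continuous_imp_quotient_map)
    show "continuous_map (subtopology A K) Y q" using q by (rule continuous_map_from_subtopology)
    show "compact_space (subtopology A K)" using K(1) by (simp add: compactin_subspace)
    show "q ` topspace (subtopology A K) = topspace Y" unfolding top by (rule K(2))
  qed (rule Y)
  have "\<exists>g. continuous_map Y Z g \<and> (\<forall>x \<in> K. g (q x) = F x)"
  proof (rule quotient_map_lift_exists[OF qm continuous_map_from_subtopology[OF F]])
    show "F x = F y" if "x \<in> topspace (subtopology A K)" "y \<in> topspace (subtopology A K)" "q x = q y" for x y
      using compat that KA unfolding top by blast
    show "\<exists>g. continuous_map Y Z g \<and> (\<forall>x \<in> K. g (q x) = F x)"
      if "continuous_map Y Z g" "\<And>x. x \<in> topspace (subtopology A K) \<Longrightarrow> g (q x) = F x" for g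
      using that unfolding top by (intro exI[of _ g]) simp
  qed
  then obtain g where g: "continuous_map Y Z g" "\<forall>x \<in> K. g (q x) = F x" by blast
  have "g (q x) = F x" if x: "x \<in> topspace A" for x
  proof -
    have "q x \<in> q ` K" using continuous_map_image_subset_topspace[OF q] K(2) x by blast
    then obtain x' where x': "x' \<in> K" "q x = q x'" by blast
    moreover have "F x = F x'" using compat[OF x _ x'(2)] x'(1) KA by blast
    ultimately show ?thesis using g(2) by simp
  qed
  with g(1) show ?thesis by blast
qed

text \<open>\<open>continuous_map_descends\<close> applies to the product of the identity of {0..1}
  with q, because {0..1} \<times> K is again compact and maps onto the product of {0..1} with
  Y.\<close>

lemma homotopic_id_descends:
  fixes q :: "'a \<Rightarrow> 'b"
  assumes q: "continuous_map A Y q" and K: "compactin A K" "q ` K = topspace Y" and Y: "Hausdorff_space Y"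
    and H: "continuous_map (prod_topology (top_of_set {0..1::real}) A) A H"
    and compat: "\<And>s x x'. s \<in> {0..1} \<Longrightarrow> x \<in> topspace A \<Longrightarrow> x' \<in> topspace A \<Longrightarrow> q x = q x' \<Longrightarrow> q (H (s, x)) = q (H (s, x'))"
    and H1: "\<And>x. x \<in> topspace A \<Longrightarrow> H (1, x) = x"
    and f: "\<And>x. x \<in> topspace A \<Longrightarrow> f (q x) = q (H (0, x))"
  shows "homotopic_with (\<lambda>x. True) Y Y f id"
proof -
  let ?I = "top_of_set {0..1::real}"
  have KA: "K \<subseteq> topspace A" using K(1) by (simp add: compactin_subspace)
  define r where "r = (\<lambda>z :: real \<times> 'a. (fst z, q (snd z)))"
  have r: "continuous_map (prod_topology ?I A) (prod_topology ?I Y) r"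
    unfolding continuous_map_pairwise r_def
    using continuous_map_fst[of ?I A] continuous_map_compose[OF continuous_map_snd[of ?I A] q] by (simp add: o_def)
  have compact: "compactin (prod_topology ?I A) ({0..1} \<times> K)"
    using K(1) by (simp add: compactin_Times)
  have "r ` ({0..1} \<times> K) = {0..1} \<times> q ` K" unfolding r_def by force
  then have onto: "r ` ({0..1} \<times> K) = topspace (prod_topology ?I Y)"
    by (simp add: K(2))
  have haus: "Hausdorff_space (prod_topology ?I Y)"
    using Y by (simp add: Hausdorff_space_prod_topology Hausdorff_space_subtopology)
  have qH: "(q \<circ> H) z = (q \<circ> H) z'"
    if z: "z \<in> topspace (prod_topology ?I A)" "z' \<in> topspace (prod_topology ?I A)" "r z = r z'" for z z'
    using z compat[of "fst z" "snd z" "snd z'"] by (cases z; cases z') (auto simp: r_def)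
  obtain H' where H': "continuous_map (prod_topology ?I Y) Y H'"
    "\<And>z. z \<in> topspace (prod_topology ?I A) \<Longrightarrow> H' (r z) = (q \<circ> H) z"
    using continuous_map_descends[OF r compact onto haus continuous_map_compose[OF H q] qH] by blast
  have "H' (0, y) = f y" "H' (1, y) = id y" if "y \<in> topspace Y" for y
  proof -
    obtain x where x: "x \<in> K" "y = q x" using \<open>y \<in> topspace Y\<close> K(2) by blast
    with KA have "x \<in> topspace A" by blast
    then show "H' (0, y) = f y" "H' (1, y) = id y"
      using H'(2)[of "(0, x)"] H'(2)[of "(1, x)"] H1 f x(2) by (simp_all add: r_def)
  qed
  with H'(1) show ?thesis by (rule homotopic_with_TrueI)
qed

text \<open>A homotopy equivalence between A and B passes to the quotients when its two maps and its
  two homotopies all respect the fibres of p and q. It serves for the space of lifts over a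
  component and the real line over the circle.\<close>

lemma homotopy_equivalent_quotients:
  assumes p: "continuous_map A Y p" "compactin A K" "p ` K = topspace Y" "Hausdorff_space Y"
    and q: "continuous_map B Z q" "compactin B L" "q ` L = topspace Z" "Hausdorff_space Z"
    and F: "continuous_map A B F"
      "\<And>x x'. x \<in> topspace A \<Longrightarrow> x' \<in> topspace A \<Longrightarrow> p x = p x' \<Longrightarrow> q (F x) = q (F x')"
    and G: "continuous_map B A G"
      "\<And>x x'. x \<in> topspace B \<Longrightarrow> x' \<in> topspace B \<Longrightarrow> q x = q x' \<Longrightarrow> p (G x) = p (G x')"
    and H: "continuous_map (prod_topology (top_of_set {0..1::real}) A) A H"
      "\<And>s x x'. s \<in> {0..1} \<Longrightarrow> x \<in> topspace A \<Longrightarrow> x' \<in> topspace A \<Longrightarrow> p x = p x' \<Longrightarrow> p (H (s, x)) = p (H (s, x'))"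
      "\<And>x. x \<in> topspace A \<Longrightarrow> H (0, x) = G (F x)" "\<And>x. x \<in> topspace A \<Longrightarrow> H (1, x) = x"
    and J: "continuous_map (prod_topology (top_of_set {0..1::real}) B) B J"
      "\<And>s x x'. s \<in> {0..1} \<Longrightarrow> x \<in> topspace B \<Longrightarrow> x' \<in> topspace B \<Longrightarrow> q x = q x' \<Longrightarrow> q (J (s, x)) = q (J (s, x'))"
      "\<And>x. x \<in> topspace B \<Longrightarrow> J (0, x) = F (G x)" "\<And>x. x \<in> topspace B \<Longrightarrow> J (1, x) = x"
  shows "Y homotopy_equivalent_space Z"
proof -
  have qF: "(q \<circ> F) x = (q \<circ> F) x'" if "x \<in> topspace A" "x' \<in> topspace A" "p x = p x'" for x x'
    unfolding o_def by (rule F(2)[OF that])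
  have pG: "(p \<circ> G) x = (p \<circ> G) x'" if "x \<in> topspace B" "x' \<in> topspace B" "q x = q x'" for x x'
    unfolding o_def by (rule G(2)[OF that])
  obtain F' where F': "continuous_map Y Z F'" "\<And>x. x \<in> topspace A \<Longrightarrow> F' (p x) = (q \<circ> F) x"
    using continuous_map_descends[OF p continuous_map_compose[OF F(1) q(1)] qF] by blast
  obtain G' where G': "continuous_map Z Y G'" "\<And>x. x \<in> topspace B \<Longrightarrow> G' (q x) = (p \<circ> G) x"
    using continuous_map_descends[OF q continuous_map_compose[OF G(1) p(1)] pG] by blast
  have FG: "F x \<in> topspace B" if "x \<in> topspace A" for x
    using continuous_map_image_subset_topspace[OF F(1)] that by blast
  have GF: "G x \<in> topspace A" if "x \<in> topspace B" for x
    using continuous_map_image_subset_topspace[OF G(1)] that by blast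
  have "homotopic_with (\<lambda>x. True) Y Y (G' \<circ> F') id"
    by (rule homotopic_id_descends[OF p H(1,2,4)]) (use F'(2) G'(2) FG H(3) in auto)
  moreover have "homotopic_with (\<lambda>x. True) Z Z (F' \<circ> G') id"
    by (rule homotopic_id_descends[OF q J(1,2,4)]) (use F'(2) G'(2) GF J(3) in auto)
  ultimately show ?thesis
    unfolding homotopy_equivalent_space_def using F'(1) G'(1) by blast
qed

section \<open>The circle as a quotient of the real line by a period\<close>

lemma cis_eq_iff: "cis x = cis y \<longleftrightarrow> (\<exists>n::int. x = y + 2 * pi * of_int n)"
proof -
  have "cis x = cis y \<longleftrightarrow> sin x = sin y \<and> cos x = cos y"
    by (simp add: complex_eq_iff conj_commute)
  then show ?thesis by (simp only: sin_cos_eq_iff)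
qed

lemma cis_period_eq_iff:
  assumes "P > 0"
  shows "cis (2 * pi * x / P) = cis (2 * pi * y / P) \<longleftrightarrow> (\<exists>n::int. x = y + P * of_int n)"
proof -
  have "2 * pi * x / P = 2 * pi * y / P + 2 * pi * of_int n \<longleftrightarrow> x = y + P * of_int n" for n :: int
  proof -
    have "2 * pi * y / P + 2 * pi * of_int n = 2 * pi * (y + P * of_int n) / P"
      using assms by (simp add: field_simps)
    then have "2 * pi * x / P = 2 * pi * y / P + 2 * pi * of_int n \<longleftrightarrow>
        2 * pi * x / P = 2 * pi * (y + P * of_int n) / P" by (simp only:)
    also have "\<dots> \<longleftrightarrow> x = y + P * of_int n" using assms by simp
    finally show ?thesis .
  qed
  then show ?thesis by (simp only: cis_eq_iff)
qed

lemma cis_period_image: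
  assumes "P > 0" shows "(\<lambda>x. cis (2 * pi * x / P)) ` {0..P} = sphere 0 1"
proof (intro equalityI subsetI)
  fix z :: complex assume "z \<in> sphere 0 1"
  then have "(Re z)\<^sup>2 + (Im z)\<^sup>2 = 1" by (simp add: cmod_def)
  then obtain t where t: "0 \<le> t" "t < 2 * pi" "Re z = cos t" "Im z = sin t"
    using sincos_total_2pi by metis
  then have "z = cis (2 * pi * (t * P / (2 * pi)) / P)"
    using assms by (simp add: complex_eq_iff)
  moreover have "t * P / (2 * pi) \<in> {0..P}"
    using t assms by (simp add: field_simps)
  ultimately show "z \<in> (\<lambda>x. cis (2 * pi * x / P)) ` {0..P}" by blast
qed auto

section \<open>The space of lifts\<close>

text \<open>Every closed walk contains a cycle, so it is enough to ask for a nonempty closed walk,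
  which is a vertex related to itself by the transitive closure.\<close>

lemma has_directed_cycle_iff:
  assumes "pair_wf_digraph D"
  shows "has_directed_cycle D \<longleftrightarrow> (\<exists>c. (c, c) \<in> (parcs D)\<^sup>+)"
proof -
  interpret pair_wf_digraph D by fact
  have ends: "arcs_ends (with_proj D) = parcs D"
    by (auto simp: arcs_ends_conv)
  have "has_directed_cycle D \<longleftrightarrow> (\<exists>p. closed_w p)"
    unfolding has_directed_cycle_def using closed_w_imp_cycle cycle_altdef by blast
  also have "\<dots> \<longleftrightarrow> (\<exists>c. (c, c) \<in> (parcs D)\<^sup>+)"
    unfolding closed_w_def using reachable1_awalk[unfolded ends] by auto
  finally show ?thesis .
qed

lemma closedin_simplex_face:
  assumes "finite U"
  shows "closedin (powertop_real U) (simplex_face U S)"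
proof -
  let ?T = "powertop_real U"
  have eval: "continuous_map ?T euclideanreal (\<lambda>t. t w)" if "w \<in> U" for w
    using that by (rule continuous_map_product_projection)
  have 1: "closedin ?T {t \<in> topspace ?T. sum t U \<in> {1}}"
    by (intro closedin_continuous_map_preimage[of _ euclideanreal] continuous_map_sum)
       (use assms eval in auto)
  have 2: "closedin ?T {t \<in> topspace ?T. t w \<in> (if w \<in> S then {0..} else {0})}" if "w \<in> U" for w
    by (intro closedin_continuous_map_preimage[of _ euclideanreal] eval that) auto
  \<comment> \<open>The sum condition, which is present for every U, keeps the intersected family
    nonempty.\<close>
  have eq: "simplex_face U S =
      \<Inter> (insert {t \<in> topspace ?T. sum t U \<in> {1}}
        ((\<lambda>w. {t \<in> topspace ?T. t w \<in> (if w \<in> S then {0..} else {0})}) ` U))"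
    by (auto simp: simplex_face_def PiE_iff split: if_splits) (metis order_refl)
  show ?thesis
    unfolding eq by (rule closedin_Inter) (use 1 2 in blast)+
qed

section \<open>The graph, its orientation and its connectivity\<close>

locale cycle_hom =
  fixes G :: "'a pair_pre_digraph" and k :: nat and f :: "'a \<Rightarrow> int"
  assumes pair_graph: "pair_graph G"
    and connected: "Digraph_Component.connected (with_proj G)"
    and card_verts: "card (pverts G) \<ge> 2"
    and k: "k \<ge> 3" "k \<noteq> 4"
    and hom: "f \<in> graph_homs G (cycle_graph k)"
begin

sublocale pair_graph G by (rule pair_graph)

abbreviation V :: "'a set" where "V \<equiv> pverts G"

definition A :: "('a \<times> 'a) set" where "A = parcs (hom_orientation k G f)"

abbreviation W :: "int set" where "W \<equiv> {0..<int k}"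

abbreviation X :: "('a \<Rightarrow> int \<Rightarrow> real) topology" where "X \<equiv> hom_complex G (cycle_graph k)"

lemma pverts_cycle_graph: "pverts (cycle_graph k) = W"
  by (simp add: cycle_graph_def)

lemma arc_cycle_graph:
  "(x, y) \<in> parcs (cycle_graph k) \<longleftrightarrow>
     x \<in> W \<and> y \<in> W \<and> ([y = x + 1] (mod int k) \<or> [x = y + 1] (mod int k))"
proof -
  have "[y - x = 1] (mod int k) \<longleftrightarrow> [y = x + 1] (mod int k)"
    by (simp add: cong_iff_dvd_diff algebra_simps)
  moreover have "[y - x = - 1] (mod int k) \<longleftrightarrow> [x = y + 1] (mod int k)"
    using cong_minus_minus_iff[of "y - x" "- 1" "int k"] by (simp add: cong_iff_dvd_diff algebra_simps)
  ultimately show ?thesis by (simp add: cycle_graph_def)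
qed

lemma f_in_W: "v \<in> V \<Longrightarrow> f v \<in> W"
  using hom by (auto simp: graph_homs_def cycle_graph_def)

lemma edge_sym: "(u, v) \<in> parcs G \<Longrightarrow> (v, u) \<in> parcs G"
  using arcs_symmetric by blast

lemma arc_cong: "(u, v) \<in> A \<Longrightarrow> [f v = f u + 1] (mod int k)"
  by (auto simp: A_def hom_orientation_def cong_iff_dvd_diff algebra_simps)

lemma arc_edge: "(u, v) \<in> A \<Longrightarrow> (u, v) \<in> parcs G"
  by (auto simp: A_def hom_orientation_def)

lemma arc_verts: "(u, v) \<in> A \<Longrightarrow> u \<in> V" "(u, v) \<in> A \<Longrightarrow> v \<in> V"
  using arc_edge in_arcsD1 in_arcsD2 by blast+

lemma edge_cases:
  assumes "(u, v) \<in> parcs G" obtains "(u, v) \<in> A" | "(v, u) \<in> A"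
proof -
  have "(f u, f v) \<in> parcs (cycle_graph k)"
    using assms hom by (auto simp: graph_homs_def)
  then have "[f v = f u + 1] (mod int k) \<or> [f u = f v + 1] (mod int k)"
    by (simp add: arc_cycle_graph)
  then have "(u, v) \<in> A \<or> (v, u) \<in> A"
    using assms edge_sym by (auto simp: A_def hom_orientation_def cong_iff_dvd_diff algebra_simps)
  with that show ?thesis by blast
qed

text \<open>Connectedness means strong connectedness of the symmetric closure, and G is already
  symmetric.\<close>

lemma edge_connected:
  assumes "u \<in> V" "v \<in> V" shows "(u, v) \<in> (parcs G)\<^sup>*"
proof -
  have "parcs (mk_symmetric (with_proj G)) \<subseteq> parcs G"
    using edge_sym by (auto simp: mk_symmetric_def)
  moreover have "u \<rightarrow>\<^sup>*\<^bsub>with_proj (mk_symmetric (with_proj G))\<^esub> v"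
    using assms connected by (simp add: connected_def strongly_connected_def mk_symmetric_def)
  from reachable_rtranclI[OF this]
  have "(u, v) \<in> (parcs (mk_symmetric (with_proj G)))\<^sup>*"
    by (simp add: arcs_ends_conv)
  ultimately show ?thesis using rtrancl_mono by blast
qed

lemma neighbour:
  assumes "v \<in> V" obtains u where "u \<in> V" "(v, u) \<in> parcs G"
proof -
  have "\<not> V \<subseteq> {v}"
    using card_verts card_mono[of "{v}" V] by auto
  then obtain w where w: "w \<in> V" "w \<noteq> v" by blast
  with edge_connected[OF assms] have "(v, w) \<in> (parcs G)\<^sup>*" by blast
  then show ?thesis
    using w that in_arcsD2 by (cases rule: converse_rtranclE) blast+
qed

lemma has_directed_cycle_iff_trancl:
  "has_directed_cycle (hom_orientation k G f) \<longleftrightarrow> (\<exists>c. (c, c) \<in> A\<^sup>+)"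
  unfolding A_def
  by (rule has_directed_cycle_iff, unfold_locales)
     (auto simp: hom_orientation_def dest: in_arcsD1 in_arcsD2)

section \<open>Lifts and the points of the complex that they represent\<close>

definition lifts :: "('a \<Rightarrow> real) set" where
  "lifts = {h \<in> V \<rightarrow>\<^sub>E UNIV. \<forall>(u, v) \<in> A. stair (h u) (h v)}"

definition point :: "('a \<Rightarrow> real) \<Rightarrow> 'a \<Rightarrow> int \<Rightarrow> real" where
  "point h = (\<lambda>v\<in>V. \<lambda>w\<in>W. weight k (f v) (h v) w)"

lemma lifts_stair: "h \<in> lifts \<Longrightarrow> (u, v) \<in> A \<Longrightarrow> stair (h u) (h v)"
  by (auto simp: lifts_def)

lemma point_in_cell:
  assumes "h \<in> V \<rightarrow>\<^sub>E UNIV" "\<And>v w. v \<in> V \<Longrightarrow> w \<in> W \<Longrightarrow> w \<notin> \<eta> v \<Longrightarrow> weight k (f v) (h v) w = 0"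
  shows "point h \<in> hom_cell G (cycle_graph k) \<eta>"
  using assms k(1) by (auto simp: hom_cell_def point_def simplex_face_def pverts_cycle_graph
      weight_nonneg sum_weight)

text \<open>The cell is spanned by the residues that belong to the floor and the ceiling of each h
  v.\<close>

lemma point_in_complex:
  assumes h: "h \<in> lifts" shows "\<exists>\<eta> \<in> multihoms G (cycle_graph k). point h \<in> hom_cell G (cycle_graph k) \<eta>"
proof
  define \<eta> where "\<eta> = (\<lambda>v\<in>V. {(f v + 2 * \<lfloor>h v\<rfloor>) mod int k, (f v + 2 * \<lceil>h v\<rceil>) mod int k})"
  have arc: "(x, y) \<in> parcs (cycle_graph k)" "(y, x) \<in> parcs (cycle_graph k)"
    if uv: "(u, v) \<in> A" and xy: "x \<in> \<eta> u" "y \<in> \<eta> v" for u v x y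
  proof -
    have u: "u \<in> V" "v \<in> V" using uv arc_verts by auto
    obtain a where a: "x = (f u + 2 * a) mod int k" "a = \<lfloor>h u\<rfloor> \<or> a = \<lceil>h u\<rceil>"
      using xy u unfolding \<eta>_def by auto
    obtain b where b: "y = (f v + 2 * b) mod int k" "b = \<lfloor>h v\<rfloor> \<or> b = \<lceil>h v\<rceil>"
      using xy u unfolding \<eta>_def by auto
    have "\<lceil>h v\<rceil> \<le> \<lfloor>h u\<rfloor>" "\<lceil>h u\<rceil> \<le> \<lfloor>h v\<rfloor> + 1"
      using lifts_stair[OF h uv] by (auto simp: stair_def)
    moreover have "\<lfloor>h u\<rfloor> \<le> \<lceil>h u\<rceil>" "\<lfloor>h v\<rfloor> \<le> \<lceil>h v\<rceil>" by linarith+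
    \<comment> \<open>For roundings a of h u and b of h v the staircase gives b \<le> a \<le> b + 1,
      so the positions f u + 2 a and f v + 2 b differ by one modulo k.\<close>
    ultimately have "b = a \<or> a = b + 1"
      using a b by linarith
    then have "[f v + 2 * b = f u + 2 * a + 1] (mod int k) \<or> [f u + 2 * a = f v + 2 * b + 1] (mod int k)"
      using cong_add[OF arc_cong[OF uv] cong_refl[of "2 * b"]]
        cong_add[OF cong_sym[OF arc_cong[OF uv]] cong_refl[of "2 * b + 1"]]
      by (auto simp: algebra_simps)
    then have "[y = x + 1] (mod int k) \<or> [x = y + 1] (mod int k)"
      unfolding a b by (simp add: cong_def mod_simps)
    then show "(x, y) \<in> parcs (cycle_graph k)" "(y, x) \<in> parcs (cycle_graph k)"
      using a b k by (auto simp: arc_cycle_graph)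
  qed
  show "\<eta> \<in> multihoms G (cycle_graph k)"
    unfolding multihoms_def
  proof (intro CollectI conjI allI impI)
    show "\<eta> \<in> V \<rightarrow>\<^sub>E Pow (pverts (cycle_graph k)) - {{}}"
      using k by (auto simp: \<eta>_def pverts_cycle_graph)
    show "\<eta> u \<times> \<eta> v \<subseteq> parcs (cycle_graph k)" if "(u, v) \<in> parcs G" for u v
      using that by (cases rule: edge_cases) (use arc in auto)
  qed
  show "point h \<in> hom_cell G (cycle_graph k) \<eta>"
  proof (rule point_in_cell)
    show "h \<in> V \<rightarrow>\<^sub>E UNIV" using h by (simp add: lifts_def)
    show "weight k (f v) (h v) w = 0" if "v \<in> V" "w \<in> W" "w \<notin> \<eta> v" for v w
    proof (rule ccontr)
      assume "weight k (f v) (h v) w \<noteq> 0"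
      from weight_support[OF k(1) this] that show False
        by (auto simp: \<eta>_def cong_residue_iff ceiling_altdef algebra_simps)
    qed
  qed
qed

lemma topspace_X: "topspace X = (\<Union>\<eta> \<in> multihoms G (cycle_graph k). hom_cell G (cycle_graph k) \<eta>)"
proof -
  have "simplex_face (pverts (cycle_graph k)) S \<subseteq> topspace (powertop_real (pverts (cycle_graph k)))" for S
    by (auto simp: simplex_face_def)
  then have "hom_cell G (cycle_graph k) \<eta> \<subseteq>
      topspace (product_topology (\<lambda>_. powertop_real (pverts (cycle_graph k))) V)" for \<eta>
    unfolding hom_cell_def topspace_product_topology by (intro PiE_mono)
  then show ?thesis
    unfolding hom_complex_def topspace_subtopology by blast
qed

lemma point_zero: "point (\<lambda>v\<in>V. 0) = hom_vertex G (cycle_graph k) f"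
proof -
  have "weight k (f v) 0 w = (if w = f v then 1 else 0)" if "v \<in> V" "w \<in> W" for v w
    using weight_singleton[OF k(1), of "f v" 0 "f v" w] that f_in_W by auto
  then show ?thesis
    by (auto simp: point_def hom_vertex_def pverts_cycle_graph intro!: restrict_ext)
qed

lemma zero_in_lifts: "(\<lambda>v\<in>V. 0) \<in> lifts"
  using arc_verts by (auto simp: lifts_def stair_def)

abbreviation lift_space :: "('a \<Rightarrow> real) topology" where
  "lift_space \<equiv> subtopology (powertop_real V) lifts"

lemma topspace_lift_space: "topspace lift_space = lifts"
  by (auto simp: lifts_def)

lemma continuous_map_eval: "v \<in> V \<Longrightarrow> continuous_map lift_space euclideanreal (\<lambda>h. h v)"
  by (intro continuous_map_from_subtopology continuous_map_product_projection)

lemma continuous_map_point: "continuous_map lift_space X point"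
proof -
  have *: "continuous_map lift_space euclideanreal (\<lambda>h. weight k (f v) (h v) w)" if "v \<in> V" for v w
    using continuous_map_compose[OF continuous_map_eval[OF that], of euclideanreal "\<lambda>x. weight k (f v) x w"]
      continuous_on_weight by (simp add: o_def)
  have "continuous_map lift_space (product_topology (\<lambda>_. powertop_real W) V) point"
    using * by (auto simp: continuous_map_componentwise point_def)
  moreover have "point \<in> topspace lift_space \<rightarrow> (\<Union>\<eta> \<in> multihoms G (cycle_graph k). hom_cell G (cycle_graph k) \<eta>)"
    using point_in_complex topspace_lift_space by blast
  ultimately show ?thesis
    unfolding hom_complex_def continuous_map_in_subtopology pverts_cycle_graph by blast
qed

text \<open>At every vertex the heights differ by an integer m v with k dividing 2 * m v. Across an
  arc both lifts drop by an amount in [0, 1], so m changes by at most 1; as k does not divide 2, it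
  does not change. Connectedness makes it constant.\<close>

lemma point_eq_imp:
  assumes h: "h \<in> lifts" "h' \<in> lifts" and eq: "point h = point h'"
  obtains m where "int k dvd 2 * m" "\<And>v. v \<in> V \<Longrightarrow> h' v = h v + of_int m"
proof -
  have "\<exists>m. h' v = h v + of_int m \<and> int k dvd 2 * m" if v: "v \<in> V" for v
  proof -
    have "weight k (f v) (h v) w = weight k (f v) (h' v) w" if "w \<in> W" for w
      using fun_cong[OF fun_cong[OF eq], of v w] that v by (simp add: point_def)
    from weight_eq_imp[OF k this] show ?thesis by metis
  qed
  then obtain m where m: "\<And>v. v \<in> V \<Longrightarrow> h' v = h v + of_int (m v)" "\<And>v. v \<in> V \<Longrightarrow> int k dvd 2 * m v"
    by metis
  have arc: "m u = m v" if uv: "(u, v) \<in> A" for u v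
  proof -
    have V: "u \<in> V" "v \<in> V" using uv arc_verts by auto
    define d where "d = m u - m v"
    have "\<bar>real_of_int d\<bar> \<le> 1"
      using stair_bounds[OF lifts_stair[OF h(1) uv]] stair_bounds[OF lifts_stair[OF h(2) uv]]
        m(1)[OF V(1)] m(1)[OF V(2)]
      by (simp add: abs_le_iff d_def)
    then have "d = -1 \<or> d = 0 \<or> d = 1" by linarith
    moreover have "int k dvd 2 * d"
      using m(2)[OF V(1)] m(2)[OF V(2)] by (simp add: d_def right_diff_distrib dvd_diff)
    ultimately have "d = 0"
      using not_dvd_2_4(2)[OF k] by auto
    then show ?thesis by (simp add: d_def)
  qed
  have const: "m u = m v" if "u \<in> V" "v \<in> V" for u v
    using edge_connected[OF that]
  proof (induction rule: rtrancl_induct)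
    case (step y z)
    from step(2) show ?case by (cases rule: edge_cases) (use step arc in auto)
  qed simp
  obtain v0 where "v0 \<in> V" using card_verts by (cases "V = {}") auto
  show ?thesis
  proof (rule that)
    show "int k dvd 2 * m v0" using \<open>v0 \<in> V\<close> by (rule m(2))
    show "h' v = h v + of_int (m v0)" if "v \<in> V" for v
      using m(1)[OF that] const[OF that \<open>v0 \<in> V\<close>] by simp
  qed
qed

lemma point_add_of_int:
  assumes "int k dvd 2 * m" shows "point (\<lambda>v\<in>V. h v + of_int m) = point h"
  unfolding point_def by (intro restrict_ext) (simp add: weight_add_of_int[OF assms])

section \<open>Cells of the complex and how they lift\<close>

lemma finite_multihoms: "finite (multihoms G (cycle_graph k))"
proof (rule finite_subset)
  show "multihoms G (cycle_graph k) \<subseteq> V \<rightarrow>\<^sub>E Pow W"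
    by (auto simp: multihoms_def pverts_cycle_graph)
  show "finite (V \<rightarrow>\<^sub>E Pow W)" by (intro finite_PiE) auto
qed

lemma closedin_hom_cell:
  assumes "\<eta> \<in> multihoms G (cycle_graph k)"
  shows "closedin X (hom_cell G (cycle_graph k) \<eta>)"
proof -
  have "closedin (product_topology (\<lambda>_. powertop_real W) V) (hom_cell G (cycle_graph k) \<eta>)"
    unfolding hom_cell_def pverts_cycle_graph closedin_product_topology
    by (simp add: closedin_simplex_face)
  moreover have "hom_cell G (cycle_graph k) \<eta> \<subseteq> topspace X"
    using assms by (auto simp: topspace_X)
  ultimately show ?thesis
    using assms unfolding hom_complex_def pverts_cycle_graph
    by (intro closedin_subset_topspace) auto
qed

text \<open>An element c of the set at some neighbour confines \<open>\<eta> v\<close> to {c - 1, c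
  + 1}. If both values occur, then every element at every neighbour is adjacent to both, and c is
  the only such vertex. Hence no edge has two choices at both ends.\<close>

lemma multihom_cases:
  assumes \<eta>: "\<eta> \<in> multihoms G (cycle_graph k)" and v: "v \<in> V"
  obtains (single) b where "b \<in> W" "\<eta> v = {b}"
    | (pair) b b' where "b \<in> W" "b' \<in> W" "[b' = b + 2] (mod int k)" "\<eta> v = {b, b'}"
        "\<And>u. (v, u) \<in> parcs G \<Longrightarrow> \<eta> u = {(b + 1) mod int k}"
proof (cases "\<exists>b. \<eta> v = {b}")
  case True
  then show ?thesis
    using \<eta> v single by (auto simp: multihoms_def pverts_cycle_graph PiE_iff)
next
  case False
  have ne: "\<eta> u \<noteq> {}" "\<eta> u \<subseteq> W" if "u \<in> V" for u
    using \<eta> that by (auto simp: multihoms_def pverts_cycle_graph PiE_iff)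
  have adj: "[y = x + 1] (mod int k) \<or> [x = y + 1] (mod int k)"
    if "(u, w) \<in> parcs G" "x \<in> \<eta> u" "y \<in> \<eta> w" for u w x y
    using \<eta> that by (fastforce simp: multihoms_def arc_cycle_graph)
  obtain u where u: "u \<in> V" "(v, u) \<in> parcs G" using neighbour[OF v] .
  obtain c where c: "c \<in> \<eta> u" using ne[OF u(1)] by blast
  define b where "b = (c - 1) mod int k"
  define b' where "b' = (c + 1) mod int k"
  have b: "b \<in> W" "b' \<in> W" using k by (auto simp: b_def b'_def)
  have bb': "[b' = b + 2] (mod int k)" by (simp add: b_def b'_def cong_def mod_simps algebra_simps)
  have "x = b \<or> x = b'" if "x \<in> \<eta> v" for x
  proof -
    have "x \<in> W" using that ne[OF v] by blast
    moreover have "[c - 1 = x] (mod int k) \<or> [c + 1 = x] (mod int k)"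
      using adj[OF u(2) that c] by (auto simp: cong_iff_dvd_diff dvd_diff_commute algebra_simps)
    ultimately show ?thesis by (auto simp: cong_residue_iff b_def b'_def)
  qed
  then have \<eta>v: "\<eta> v = {b, b'}" using False ne[OF v] by blast
  have "\<eta> w = {(b + 1) mod int k}" if vw: "(v, w) \<in> parcs G" for w
  proof -
    have w: "w \<in> V" using vw in_arcsD2 by blast
    have "y = (b + 1) mod int k" if y: "y \<in> \<eta> w" for y
    proof -
      have "y \<in> W" using y ne[OF w] by blast
      have "[y = b + 1] (mod int k)"
      proof (rule ccontr)
        assume neg: "\<not> ?thesis"
        then have 1: "int k dvd b - (y + 1)"
          using adj[OF vw _ y, of b] \<eta>v by (auto simp: cong_iff_dvd_diff)
        from bb' have 2: "int k dvd b' - (b + 2)" by (simp add: cong_iff_dvd_diff)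
        from adj[OF vw _ y, of b'] \<eta>v consider "int k dvd y - (b' + 1)" | "int k dvd b' - (y + 1)"
          by (auto simp: cong_iff_dvd_diff)
        then show False
        proof cases
          case 3: 1
          \<comment> \<open>Here y is congruent both to b - 1 and to b + 3, so k would divide
            4.\<close>
          have "int k dvd (y - (b' + 1)) + (b - (y + 1)) + (b' - (b + 2))"
            by (intro dvd_add 1 2 3)
          then have "int k dvd - 4" by simp
          then show False using not_dvd_2_4[OF k] by simp
        next
          case 4: 2
          have "int k dvd (b' - (b + 2)) - (b' - (y + 1))" by (intro dvd_diff 2 4)
          moreover have "(b' - (b + 2)) - (b' - (y + 1)) = y - (b + 1)" by simp
          ultimately have "[y = b + 1] (mod int k)" by (simp only: cong_iff_dvd_diff)
          with neg show False by blast
        qed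
      qed
      then show ?thesis using \<open>y \<in> W\<close> cong_residue_iff cong_sym by blast
    qed
    with ne[OF w] show ?thesis by blast
  qed
  then show ?thesis by (rule pair[OF b bb' \<eta>v])
qed

text \<open>In the second case n is the start of a unit interval that contains h v and lifts the
  segment of the cell at v. As h v may be the right end point, n need not be its floor.\<close>

lemma lift_in_cell:
  assumes \<eta>: "\<eta> \<in> multihoms G (cycle_graph k)"
    and h: "h \<in> lifts" "point h \<in> hom_cell G (cycle_graph k) \<eta>" and v: "v \<in> V"
  obtains (single) n where "h v = of_int n" "\<eta> v = {(f v + 2 * n) mod int k}"
    | (pair) n where "of_int n \<le> h v" "h v \<le> of_int n + 1"
        "\<eta> v = {(f v + 2 * n) mod int k, (f v + 2 * n + 2) mod int k}"
        "\<And>u. (v, u) \<in> parcs G \<Longrightarrow> \<eta> u = {(f v + 2 * n + 1) mod int k}"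
proof -
  have 0: "weight k (f v) (h v) w = 0" if "w \<in> W" "w \<notin> \<eta> v" for w
    using h(2) v that by (auto simp: hom_cell_def simplex_face_def pverts_cycle_graph point_def PiE_iff)
  from \<eta> v show ?thesis
  proof (cases rule: multihom_cases)
    case b: (single b)
    obtain n where "h v = of_int n" "[f v + 2 * n = b] (mod int k)"
      using weight_supported_singleton[OF k(1), of b "f v" "h v"] 0 b by auto
    moreover from this have "b = (f v + 2 * n) mod int k"
      using cong_residue_iff[OF b(1)] by blast
    ultimately show ?thesis
      using single[of n] b(2) by simp
  next
    case b: (pair b b')
    obtain n where n: "of_int n \<le> h v" "h v \<le> of_int n + 1" "[f v + 2 * n = b] (mod int k)"
      using weight_supported_pair[OF k b(3), of "f v" "h v"] 0 b by auto
    have n1: "b = (f v + 2 * n) mod int k"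
      using cong_residue_iff[OF b(1)] n(3) by blast
    moreover have "b' = (f v + 2 * n + 2) mod int k"
      using cong_residue_iff[OF b(2)] cong_trans[OF cong_add[OF n(3) cong_refl[of 2]] cong_sym[OF b(3)]] by blast
    moreover have "(b + 1) mod int k = (f v + 2 * n + 1) mod int k"
      by (simp add: n1 mod_simps)
    ultimately show ?thesis
      using pair[OF n(1,2)] b(4,5) by metis
  qed
qed

text \<open>The whole cell lifts to the box \<open>PiE V J\<close>, whose factor at v is a unit
  interval if \<open>\<eta> v\<close> has two elements and an integer otherwise. The box contains h,
  is path connected and consists of lifts, so any point t of the cell is reached from h without
  leaving \<open>lifts\<close>.\<close>

lemma cell_lift:
  assumes \<eta>: "\<eta> \<in> multihoms G (cycle_graph k)"
    and h: "h \<in> lifts" "point h \<in> hom_cell G (cycle_graph k) \<eta>"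
    and t: "t \<in> hom_cell G (cycle_graph k) \<eta>"
  obtains g where "path_component_of lift_space h g" "point g = t"
proof -
  define single where "single v n \<longleftrightarrow> h v = of_int n \<and> \<eta> v = {(f v + 2 * n) mod int k}" for v n
  define pair where "pair v n \<longleftrightarrow> of_int n \<le> h v \<and> h v \<le> of_int n + 1 \<and>
      \<eta> v = {(f v + 2 * n) mod int k, (f v + 2 * n + 2) mod int k} \<and>
      (\<forall>u. (v, u) \<in> parcs G \<longrightarrow> \<eta> u = {(f v + 2 * n + 1) mod int k})" for v n
  have "\<exists>n. single v n \<or> pair v n" if "v \<in> V" for v
    using lift_in_cell[OF \<eta> h that] unfolding single_def pair_def by metis
  then obtain n where n: "\<And>v. v \<in> V \<Longrightarrow> single v (n v) \<or> pair v (n v)" by metis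
  have not_both: "\<not> (\<eta> v = {x} \<and> pair v m)" for v x m
  proof
    assume "\<eta> v = {x} \<and> pair v m"
    then have "(f v + 2 * m) mod int k = (f v + 2 * m + 2) mod int k"
      unfolding pair_def by (metis insertI1 insertI2 singletonD)
    then have "[f v + 2 * m + 2 = f v + 2 * m] (mod int k)" by (simp add: cong_def)
    then show False using not_dvd_2_4(2)[OF k] by (simp add: cong_iff_dvd_diff)
  qed
  have small: "d = 0" if "int k dvd 2 * d" "d = -1 \<or> d = 0 \<or> d = 1" for d
    using that not_dvd_2_4(2)[OF k] by auto
  define J where "J v = (if pair v (n v) then {of_int (n v)..of_int (n v) + 1} else {real_of_int (n v)})" for v
  have arc: "stair x y" if uv: "(u, v) \<in> A" and xy: "x \<in> J u" "y \<in> J v" for u v x y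
  proof -
    have V: "u \<in> V" "v \<in> V" using uv arc_verts by auto
    have st: "stair (h u) (h v)" using lifts_stair[OF h(1) uv] .
    note bnd = stair_bounds[OF st]
    have "(u, v) \<in> parcs G" "(v, u) \<in> parcs G" using uv arc_edge edge_sym by auto
    \<comment> \<open>A pair at one end of an edge forces a singleton at the other.\<close>
    consider "single u (n u)" "single v (n v)" | "pair u (n u)" "single v (n v)" | "pair v (n v)" "single u (n u)"
      using n[OF V(1)] n[OF V(2)] not_both \<open>(u, v) \<in> parcs G\<close> unfolding pair_def by metis
    then show ?thesis
    proof cases
      case 1
      then have "\<not> pair u (n u)" "\<not> pair v (n v)" using not_both unfolding single_def by blast+
      then have "x = h u" "y = h v" using xy 1 by (auto simp: J_def single_def)
      with st show ?thesis by simp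
    next
      case 2
      then have "\<not> pair v (n v)" using not_both unfolding single_def by blast
      then have y: "y = of_int (n v)" and x: "of_int (n u) \<le> x" "x \<le> of_int (n u) + 1"
        using xy 2 by (auto simp: J_def)
      \<comment> \<open>The congruence determines n v - n u only up to integers m with k dividing 2
        * m. Since h itself obeys the staircase, the difference is at most 1 in absolute value,
        hence 0: a horizontal segment of the staircase.\<close>
      have "(f v + 2 * n v) mod int k = (f u + 2 * n u + 1) mod int k"
        using 2 \<open>(u, v) \<in> parcs G\<close> unfolding single_def pair_def by (metis singleton_inject)
      then have "int k dvd (f v + 2 * n v) - (f u + 2 * n u + 1)"
        by (simp add: cong_def flip: cong_iff_dvd_diff)
      moreover have "int k dvd f v - (f u + 1)" using arc_cong[OF uv] by (simp add: cong_iff_dvd_diff)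
      ultimately have "int k dvd ((f v + 2 * n v) - (f u + 2 * n u + 1)) - (f v - (f u + 1))"
        by (rule dvd_diff)
      then have "int k dvd 2 * (n v - n u)" by (simp add: algebra_simps)
      moreover have "n v - n u = -1 \<or> n v - n u = 0 \<or> n v - n u = 1"
      proof -
        have "real_of_int (n v) \<le> of_int (n u) + 1" "real_of_int (n u) \<le> of_int (n v) + 1"
          using bnd 2 unfolding single_def pair_def by linarith+
        then show ?thesis by linarith
      qed
      ultimately have "n v - n u = 0" by (rule small)
      then show ?thesis using x y stair_of_int(1) by simp
    next
      case 3
      then have "\<not> pair u (n u)" using not_both unfolding single_def by blast
      then have x: "x = of_int (n u)" and y: "of_int (n v) \<le> y" "y \<le> of_int (n v) + 1"
        using xy 3 by (auto simp: J_def)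
      \<comment> \<open>The same argument gives n u = n v + 1: a vertical segment of the
        staircase.\<close>
      have "(f u + 2 * n u) mod int k = (f v + 2 * n v + 1) mod int k"
        using 3 \<open>(v, u) \<in> parcs G\<close> unfolding single_def pair_def by (metis singleton_inject)
      then have "int k dvd (f u + 2 * n u) - (f v + 2 * n v + 1)"
        by (simp add: cong_def flip: cong_iff_dvd_diff)
      moreover have "int k dvd f v - (f u + 1)" using arc_cong[OF uv] by (simp add: cong_iff_dvd_diff)
      ultimately have "int k dvd ((f u + 2 * n u) - (f v + 2 * n v + 1)) + (f v - (f u + 1))"
        by (rule dvd_add)
      then have "int k dvd 2 * (n u - n v - 1)" by (simp add: algebra_simps)
      moreover have "n u - n v - 1 = -1 \<or> n u - n v - 1 = 0 \<or> n u - n v - 1 = 1"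
      proof -
        have "real_of_int (n v) \<le> of_int (n u)" "real_of_int (n u) \<le> of_int (n v) + 2"
          using bnd 3 unfolding single_def pair_def by linarith+
        then show ?thesis by linarith
      qed
      ultimately have "n u - n v - 1 = 0" by (rule small)
      then have "n u = n v + 1" by simp
      then show ?thesis using x y stair_of_int(2) by simp
    qed
  qed
  have "PiE V J \<subseteq> lifts"
    using arc arc_verts by (fastforce simp: lifts_def PiE_iff)
  moreover have "path_connectedin (powertop_real V) (PiE V J)"
    by (simp add: path_connectedin_PiE J_def convex_imp_path_connected)
  ultimately have "path_connectedin lift_space (PiE V J)"
    by (simp add: path_connectedin_subtopology)
  moreover have "h \<in> PiE V J"
    using h(1) n not_both by (auto simp: lifts_def PiE_iff J_def single_def pair_def)
  \<comment> \<open>The coordinate of t at the far end of a segment is the distance travelled along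
    the unit interval that lifts it.\<close>
  moreover define g where "g = (\<lambda>v\<in>V.
      if pair v (n v) then of_int (n v) + t v ((f v + 2 * n v + 2) mod int k) else of_int (n v))"
  have in_W: "y mod int k \<in> W" for y using k by simp
  have t_simp: "t v w \<ge> 0" "w \<notin> \<eta> v \<Longrightarrow> t v w = 0" if "v \<in> V" "w \<in> W" for v w
    using t that by (auto simp: hom_cell_def pverts_cycle_graph simplex_face_def PiE_iff)
  have t_sum: "sum (t v) W = 1" if "v \<in> V" for v
    using t that by (auto simp: hom_cell_def pverts_cycle_graph simplex_face_def PiE_iff)
  have gv: "g v \<in> J v \<and> (\<forall>w\<in>W. weight k (f v) (g v) w = t v w)" if v: "v \<in> V" for v
  proof (cases "pair v (n v)")
    case True
    define b where "b = (f v + 2 * n v) mod int k"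
    define b' where "b' = (f v + 2 * n v + 2) mod int k"
    have b: "b \<in> W" "b' \<in> W" using in_W by (auto simp: b_def b'_def)
    have cong: "[f v + 2 * n v = b] (mod int k)" "[b' = b + 2] (mod int k)"
      by (auto simp: b_def b'_def cong_def mod_simps)
    have \<eta>v: "\<eta> v = {b, b'}" using True by (simp add: pair_def b_def b'_def)
    have "b \<noteq> b'" using not_both True \<eta>v by auto
    have "sum (t v) {b, b'} = sum (t v) W"
      using b \<eta>v t_simp(2)[OF v] by (intro sum.mono_neutral_left) auto
    then have sum: "t v b + t v b' = 1" using \<open>b \<noteq> b'\<close> t_sum[OF v] by simp
    have g: "g v = of_int (n v) + t v b'" using v True by (simp add: g_def b'_def)
    have s: "0 \<le> t v b'" "t v b' \<le> 1" using sum t_simp(1)[OF v b(1)] t_simp(1)[OF v b(2)] by auto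
    have "weight k (f v) (g v) w = t v w" if w: "w \<in> W" for w
      unfolding g weight_pair[OF k(1) cong w b s] using sum t_simp(2)[OF v w] \<eta>v by auto
    then show ?thesis using g s True by (simp add: J_def)
  next
    case False
    define b where "b = (f v + 2 * n v) mod int k"
    have b: "b \<in> W" using in_W by (auto simp: b_def)
    have cong: "[f v + 2 * n v = b] (mod int k)"
      by (auto simp: b_def cong_def)
    have \<eta>v: "\<eta> v = {b}" using False n[OF v] by (simp add: single_def b_def)
    have "sum (t v) {b} = sum (t v) W"
      using b \<eta>v t_simp(2)[OF v] by (intro sum.mono_neutral_left) auto
    then have sum: "t v b = 1" using t_sum[OF v] by simp
    have g: "g v = of_int (n v)" using v False by (simp add: g_def)
    have "weight k (f v) (g v) w = t v w" if w: "w \<in> W" for w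
      unfolding g weight_singleton[OF k(1) cong w b] using sum t_simp(2)[OF v w] \<eta>v by auto
    then show ?thesis using g False by (simp add: J_def)
  qed
  then have "g \<in> PiE V J" by (simp add: g_def PiE_iff)
  ultimately have "path_component_of lift_space h g"
    unfolding path_component_of by blast
  moreover have "point g = t"
  proof -
    have ext: "t \<in> extensional V" "\<And>v. v \<in> V \<Longrightarrow> t v \<in> extensional W"
      using t by (auto simp: hom_cell_def pverts_cycle_graph simplex_face_def PiE_iff)
    show ?thesis
    proof (rule extensionalityI)
      show "point g \<in> extensional V" by (simp add: point_def)
      show "t \<in> extensional V" by (rule ext)
      show "point g v = t v" if "v \<in> V" for v
        by (rule extensionalityI[of _ W]) (use that ext(2) gv in \<open>auto simp: point_def\<close>)
    qed
  qed
  ultimately show ?thesis by (rule that)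
qed

section \<open>The component of f as the image of a path component of lifts\<close>

definition base_lifts :: "('a \<Rightarrow> real) set" where
  "base_lifts = path_component_of_set lift_space (\<lambda>v\<in>V. 0)"

lemma base_lifts_subset: "base_lifts \<subseteq> lifts"
  using path_component_of_subset_topspace[of lift_space] unfolding base_lifts_def topspace_lift_space .

lemma zero_in_base_lifts: "(\<lambda>v\<in>V. 0) \<in> base_lifts"
  unfolding base_lifts_def mem_Collect_eq path_component_of_refl topspace_lift_space
  by (rule zero_in_lifts)

lemma base_lifts_trans:
  "h \<in> base_lifts \<Longrightarrow> path_component_of lift_space h g \<Longrightarrow> g \<in> base_lifts"
  unfolding base_lifts_def mem_Collect_eq by (rule path_component_of_trans)

text \<open>By \<open>cell_lift\<close> a cell that meets the image lies inside it. The image and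
  its complement are therefore finite unions of closed cells, so the image is open and closed; it is
  also connected and contains the vertex of f.\<close>

lemma Conn_eq: "connected_component_of_set X (hom_vertex G (cycle_graph k) f) = point ` base_lifts"
  and closedin_Conn: "closedin X (point ` base_lifts)"
proof -
  let ?Q = "point ` base_lifts" and ?M = "multihoms G (cycle_graph k)"
  let ?c = "hom_cell G (cycle_graph k)"
  have sat: "?c \<eta> \<subseteq> ?Q" if \<eta>: "\<eta> \<in> ?M" and x: "x \<in> ?c \<eta>" "x \<in> ?Q" for \<eta> x
  proof
    fix t assume t: "t \<in> ?c \<eta>"
    obtain h where h: "h \<in> base_lifts" "point h \<in> ?c \<eta>" using x by blast
    obtain g where "path_component_of lift_space h g" "point g = t"
      using cell_lift[OF \<eta> _ h(2) t] h(1) base_lifts_subset by blast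
    then show "t \<in> ?Q" using base_lifts_trans[OF h(1)] by blast
  qed
  have Q: "?Q \<subseteq> topspace X"
    using continuous_map_image_subset_topspace[OF continuous_map_point] image_mono[OF base_lifts_subset]
    unfolding topspace_lift_space by (rule order_trans[rotated])
  have "?Q = \<Union> (?c ` {\<eta> \<in> ?M. ?c \<eta> \<subseteq> ?Q})"
  proof (rule equalityI; rule subsetI)
    fix x assume x: "x \<in> ?Q"
    with Q obtain \<eta> where "\<eta> \<in> ?M" "x \<in> ?c \<eta>" unfolding topspace_X by auto
    with sat[OF this x] show "x \<in> \<Union> (?c ` {\<eta> \<in> ?M. ?c \<eta> \<subseteq> ?Q})" by blast
  qed auto
  moreover have "closedin X (\<Union> (?c ` {\<eta> \<in> ?M. ?c \<eta> \<subseteq> ?Q}))"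
    using finite_multihoms closedin_hom_cell by (intro closedin_Union) auto
  ultimately show closed: "closedin X ?Q" by simp
  have "topspace X - ?Q = \<Union> (?c ` {\<eta> \<in> ?M. ?c \<eta> \<inter> ?Q = {}})"
  proof (rule equalityI; rule subsetI)
    fix x assume x: "x \<in> topspace X - ?Q"
    then obtain \<eta> where \<eta>: "\<eta> \<in> ?M" "x \<in> ?c \<eta>" unfolding topspace_X by auto
    have "?c \<eta> \<inter> ?Q = {}" using sat[OF \<eta>(1)] \<eta>(2) x by blast
    with \<eta> show "x \<in> \<Union> (?c ` {\<eta> \<in> ?M. ?c \<eta> \<inter> ?Q = {}})" by blast
  next
    fix x assume "x \<in> \<Union> (?c ` {\<eta> \<in> ?M. ?c \<eta> \<inter> ?Q = {}})"
    then show "x \<in> topspace X - ?Q" unfolding topspace_X by blast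
  qed
  moreover have "closedin X (\<Union> (?c ` {\<eta> \<in> ?M. ?c \<eta> \<inter> ?Q = {}}))"
    using finite_multihoms closedin_hom_cell by (intro closedin_Union) auto
  ultimately have "openin X ?Q" using Q by (simp add: openin_closedin)
  show "connected_component_of_set X (hom_vertex G (cycle_graph k) f) = ?Q"
  proof (rule connected_component_of_unique)
    show in_Q: "hom_vertex G (cycle_graph k) f \<in> ?Q"
      using point_zero zero_in_base_lifts by (metis image_eqI)
    show "connectedin X ?Q"
      unfolding base_lifts_def
      by (intro path_connectedin_imp_connectedin path_connectedin_continuous_map_image[OF continuous_map_point]
          path_connectedin_path_component_of)
    show "C \<subseteq> ?Q" if "hom_vertex G (cycle_graph k) f \<in> C \<and> connectedin X C" for C
      using connectedin_clopen_cases[OF _ closed \<open>openin X ?Q\<close>, of C] that in_Q by (auto simp: disjnt_def)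
  qed
qed

subsection \<open>Lattice structure and compactness\<close>

definition join :: "('a \<Rightarrow> real) \<Rightarrow> ('a \<Rightarrow> real) \<Rightarrow> 'a \<Rightarrow> real" where
  "join h g = (\<lambda>v\<in>V. max (h v) (g v))"

definition meet :: "('a \<Rightarrow> real) \<Rightarrow> ('a \<Rightarrow> real) \<Rightarrow> 'a \<Rightarrow> real" where
  "meet h g = (\<lambda>v\<in>V. min (h v) (g v))"

lemma lifts_ext: "h \<in> lifts \<Longrightarrow> h \<in> extensional V"
  by (simp add: lifts_def PiE_iff)

lemma join_in_lifts: "h \<in> lifts \<Longrightarrow> g \<in> lifts \<Longrightarrow> join h g \<in> lifts"
  using arc_verts by (auto simp: lifts_def join_def intro!: stair_max)

lemma meet_in_lifts: "h \<in> lifts \<Longrightarrow> g \<in> lifts \<Longrightarrow> meet h g \<in> lifts"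
  using arc_verts by (auto simp: lifts_def meet_def intro!: stair_min)

lemma continuous_map_lift_space:
  assumes "\<And>v. v \<in> V \<Longrightarrow> continuous_map Y euclideanreal (\<lambda>y. F y v)"
    and "\<And>y. y \<in> topspace Y \<Longrightarrow> F y \<in> lifts"
  shows "continuous_map Y lift_space F"
proof -
  have "F ` topspace Y \<subseteq> extensional V" using assms(2) lifts_ext by auto
  with assms(1) have "continuous_map Y (powertop_real V) F"
    by (simp add: continuous_map_componentwise)
  with assms(2) show ?thesis
    by (simp add: continuous_map_in_subtopology)
qed

lemma continuous_map_coord:
  assumes "continuous_map Y lift_space F" "v \<in> V"
  shows "continuous_map Y euclideanreal (\<lambda>y. F y v)"
  using continuous_map_compose[OF assms(1) continuous_map_eval[OF assms(2)]] by (simp add: o_def)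

lemma continuous_map_in_lifts:
  "continuous_map Y lift_space F \<Longrightarrow> y \<in> topspace Y \<Longrightarrow> F y \<in> lifts"
  using continuous_map_image_subset_topspace topspace_lift_space by blast

lemma continuous_map_join:
  assumes "continuous_map Y lift_space F" "continuous_map Y lift_space F'"
  shows "continuous_map Y lift_space (\<lambda>y. join (F y) (F' y))"
proof (rule continuous_map_lift_space)
  show "continuous_map Y euclideanreal (\<lambda>y. join (F y) (F' y) v)" if "v \<in> V" for v
    using that continuous_map_coord[OF assms(1) that] continuous_map_coord[OF assms(2) that]
    by (simp add: join_def continuous_map_real_max)
qed (intro join_in_lifts continuous_map_in_lifts[OF assms(1)] continuous_map_in_lifts[OF assms(2)])

lemma continuous_map_meet:
  assumes "continuous_map Y lift_space F" "continuous_map Y lift_space F'"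
  shows "continuous_map Y lift_space (\<lambda>y. meet (F y) (F' y))"
proof (rule continuous_map_lift_space)
  show "continuous_map Y euclideanreal (\<lambda>y. meet (F y) (F' y) v)" if "v \<in> V" for v
    using that continuous_map_coord[OF assms(1) that] continuous_map_coord[OF assms(2) that]
    by (simp add: meet_def continuous_map_real_min)
qed (intro meet_in_lifts continuous_map_in_lifts[OF assms(1)] continuous_map_in_lifts[OF assms(2)])

lemma base_lifts_iff_path:
  "h \<in> base_lifts \<longleftrightarrow> (\<exists>p. pathin lift_space p \<and> p 0 = (\<lambda>v\<in>V. 0) \<and> p 1 = h)"
  by (simp add: base_lifts_def path_component_of_def)

text \<open>The join, taken at each time, of two paths that start at zero is a path of lifts that
  starts at zero.\<close>

lemma join_in_base_lifts:
  assumes "h \<in> base_lifts" "g \<in> base_lifts" shows "join h g \<in> base_lifts"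
proof -
  obtain p q where p: "pathin lift_space p" "p 0 = (\<lambda>v\<in>V. 0)" "p 1 = h"
    and q: "pathin lift_space q" "q 0 = (\<lambda>v\<in>V. 0)" "q 1 = g"
    using assms base_lifts_iff_path by blast
  have "pathin lift_space (\<lambda>t. join (p t) (q t))"
    using p(1) q(1) unfolding pathin_def by (rule continuous_map_join)
  moreover have "join (\<lambda>v\<in>V. 0) (\<lambda>v\<in>V. 0) = (\<lambda>v\<in>V. 0)"
    by (auto simp: join_def)
  ultimately show ?thesis
    unfolding base_lifts_iff_path using p q by (intro exI[of _ "\<lambda>t. join (p t) (q t)"]) simp
qed

lemma meet_in_base_lifts:
  assumes "h \<in> base_lifts" "g \<in> base_lifts" shows "meet h g \<in> base_lifts"
proof -
  obtain p q where p: "pathin lift_space p" "p 0 = (\<lambda>v\<in>V. 0)" "p 1 = h"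
    and q: "pathin lift_space q" "q 0 = (\<lambda>v\<in>V. 0)" "q 1 = g"
    using assms base_lifts_iff_path by blast
  have "pathin lift_space (\<lambda>t. meet (p t) (q t))"
    using p(1) q(1) unfolding pathin_def by (rule continuous_map_meet)
  moreover have "meet (\<lambda>v\<in>V. 0) (\<lambda>v\<in>V. 0) = (\<lambda>v\<in>V. 0)"
    by (auto simp: meet_def)
  ultimately show ?thesis
    unfolding base_lifts_iff_path using p q by (intro exI[of _ "\<lambda>t. meet (p t) (q t)"]) simp
qed

section \<open>Boundedness, closedness and compactness of sets of lifts\<close>

lemma edge_bound:
  assumes "h \<in> lifts" "(u, v) \<in> parcs G" shows "\<bar>h u - h v\<bar> \<le> 1"
  using assms(2)
  by (cases rule: edge_cases) (use stair_bounds[OF lifts_stair[OF assms(1)]] in \<open>force simp: abs_le_iff\<close>)+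

text \<open>Each edge of a walk contributes at most 1, so a walk from u to v bounds the difference
  for all lifts at once, and there are finitely many pairs of vertices.\<close>

lemma lifts_bounded:
  obtains D where "\<And>h u v. h \<in> lifts \<Longrightarrow> u \<in> V \<Longrightarrow> v \<in> V \<Longrightarrow> \<bar>h u - h v\<bar> \<le> D"
proof -
  have "\<exists>D. \<forall>h \<in> lifts. \<bar>h u - h v\<bar> \<le> D" if "u \<in> V" "v \<in> V" for u v
    using edge_connected[OF that]
  proof (induction rule: rtrancl_induct)
    case base
    then show ?case by (intro exI[of _ 0]) simp
  next
    case (step y z)
    then obtain D where D: "\<forall>h \<in> lifts. \<bar>h u - h y\<bar> \<le> D" by blast
    have "\<bar>h u - h z\<bar> \<le> D + 1" if "h \<in> lifts" for h
      using D edge_bound[OF that step(2)] that by fastforce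
    then show ?case by blast
  qed
  then obtain D where D: "\<And>u v h. u \<in> V \<Longrightarrow> v \<in> V \<Longrightarrow> h \<in> lifts \<Longrightarrow> \<bar>h u - h v\<bar> \<le> D u v"
    by metis
  show ?thesis
  proof (rule that)
    fix h u v assume h: "h \<in> lifts" and V: "u \<in> V" "v \<in> V"
    have "\<bar>h u - h v\<bar> \<le> D u v" by (rule D[OF V h])
    also have "\<dots> \<le> Max ((\<lambda>(u, v). D u v) ` (V \<times> V))"
      using V by (intro Max_ge) auto
    finally show "\<bar>h u - h v\<bar> \<le> Max ((\<lambda>(u, v). D u v) ` (V \<times> V))" .
  qed
qed

lemma closedin_lifts: "closedin (powertop_real V) lifts"
proof -
  let ?T = "powertop_real V"
  have eval: "continuous_map ?T euclideanreal (\<lambda>h. h v)" if "v \<in> V" for v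
    using that by (rule continuous_map_product_projection)
  define B where "B e n = ({h \<in> topspace ?T. h (snd e) \<in> {..of_int n}} \<union> {h \<in> topspace ?T. h (fst e) \<in> {of_int n + 1..}})
    \<inter> ({h \<in> topspace ?T. h (fst e) \<in> {..of_int n}} \<union> {h \<in> topspace ?T. h (snd e) \<in> {of_int n..}})"
    for e and n :: int
  have mem: "h \<in> B (u, v) n \<longleftrightarrow> h \<in> V \<rightarrow>\<^sub>E UNIV \<and> (h v \<le> of_int n \<or> of_int n + 1 \<le> h u) \<and>
      (h u \<le> of_int n \<or> of_int n \<le> h v)" for h u v n
    unfolding B_def by auto
  have "closedin ?T (B e n)" if "e \<in> A" for e n
    unfolding B_def using arc_verts[of "fst e" "snd e"] that
    by (intro closedin_Int closedin_Un closedin_continuous_map_preimage[of _ euclideanreal] eval; simp)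
  \<comment> \<open>Inserting the whole space makes the family visibly nonempty and supplies the
    membership in the function space.\<close>
  then have "closedin ?T (\<Inter> (insert (topspace ?T) (case_prod B ` (A \<times> UNIV))))"
    using closedin_topspace[of ?T] by (intro closedin_Inter) auto
  also have "\<Inter> (insert (topspace ?T) (case_prod B ` (A \<times> UNIV))) = lifts"
  proof (rule set_eqI)
    fix h
    have "h \<in> \<Inter> (insert (topspace ?T) (case_prod B ` (A \<times> UNIV))) \<longleftrightarrow>
        h \<in> V \<rightarrow>\<^sub>E UNIV \<and> (\<forall>u v. (u, v) \<in> A \<longrightarrow> (\<forall>n. h \<in> B (u, v) n))"
      by auto
    also have "\<dots> \<longleftrightarrow> h \<in> lifts"
      unfolding lifts_def stair_iff mem by blast
    finally show "h \<in> \<Inter> (insert (topspace ?T) (case_prod B ` (A \<times> UNIV))) \<longleftrightarrow> h \<in> lifts" .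
  qed
  finally show ?thesis .
qed

text \<open>Bounding the height at one vertex bounds all heights, so the slab is a closed subset of
  a compact box.\<close>

lemma compactin_slab:
  assumes c: "c \<in> V" shows "compactin lift_space {h \<in> lifts. h c \<in> {a..b}}"
proof -
  obtain D where D: "\<And>h u v. h \<in> lifts \<Longrightarrow> u \<in> V \<Longrightarrow> v \<in> V \<Longrightarrow> \<bar>h u - h v\<bar> \<le> D"
    using lifts_bounded by blast
  let ?T = "powertop_real V"
  let ?S = "{h \<in> lifts. h c \<in> {a..b}}"
  have "compactin ?T (PiE V (\<lambda>_. {a - D..b + D}))"
    by (simp add: compactin_PiE)
  moreover have "closedin ?T ?S"
    by (intro closedin_continuous_map_preimage_gen[of _ euclideanreal] closedin_lifts
        continuous_map_product_projection c) simp
  moreover have "?S \<subseteq> PiE V (\<lambda>_. {a - D..b + D})"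
  proof
    fix h assume h: "h \<in> ?S"
    then have "h v \<in> {a - D..b + D}" if "v \<in> V" for v
      using D[of h v c] c that by (simp add: abs_le_iff)
    with h show "h \<in> PiE V (\<lambda>_. {a - D..b + D})"
      using lifts_ext by (simp add: PiE_iff)
  qed
  ultimately have "compactin ?T ?S"
    using closed_compactin by blast
  then show ?thesis by (simp add: compactin_subtopology)
qed

lemma Hausdorff_X: "Hausdorff_space X"
  unfolding hom_complex_def
  by (intro Hausdorff_space_subtopology) (simp add: Hausdorff_space_product_topology)

subsection \<open>Orientations with a directed cycle\<close>

text \<open>For a closed walk at c this says that the ceiling of h c is at most its floor, so h c is
  an integer.\<close>

lemma directed_walk_le:
  assumes "h \<in> lifts" "(u, v) \<in> A\<^sup>+" shows "\<lceil>h v\<rceil> \<le> \<lfloor>h u\<rfloor>"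
  using assms(2)
proof (induction rule: trancl_induct)
  case (base v)
  then show ?case using lifts_stair[OF assms(1)] by (simp add: stair_def)
next
  case (step v w)
  have "\<lfloor>h v\<rfloor> \<le> \<lceil>h v\<rceil>" by linarith
  moreover have "\<lceil>h w\<rceil> \<le> \<lfloor>h v\<rfloor>" using lifts_stair[OF assms(1) step(2)] by (simp add: stair_def)
  ultimately show ?case using step(3) by linarith
qed

lemma trancl_verts: "(u, v) \<in> A\<^sup>+ \<Longrightarrow> u \<in> V" "(u, v) \<in> A\<^sup>+ \<Longrightarrow> v \<in> V"
  by (induction rule: trancl_induct) (auto dest: arc_verts)

text \<open>The heights at c of all lifts in \<open>base_lifts\<close> form a connected set of
  integers. It is countable, hence a single point, and the zero lift shows which.\<close>

lemma base_lifts_zero_on_cycle: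
  assumes h: "h \<in> base_lifts" and c: "(c, c) \<in> A\<^sup>+"
  shows "h c = 0"
proof -
  have V: "c \<in> V" using trancl_verts c by blast
  have "path_connectedin lift_space base_lifts"
    unfolding base_lifts_def by (rule path_connectedin_path_component_of)
  from path_connectedin_continuous_map_image[OF continuous_map_eval[OF V] this]
  have conn: "Topological_Spaces.connected ((\<lambda>h. h c) ` base_lifts)"
    by (simp add: path_connected_imp_connected)
  have "g c \<in> \<int>" if "g \<in> base_lifts" for g
  proof -
    have "\<lceil>g c\<rceil> \<le> \<lfloor>g c\<rfloor>" using directed_walk_le[OF _ c] that base_lifts_subset by blast
    then have "g c = of_int \<lfloor>g c\<rfloor>" by linarith
    then show ?thesis by (metis Ints_of_int)
  qed
  then have "countable ((\<lambda>h. h c) ` base_lifts)"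
    by (intro countable_subset[OF _ countable_int]) blast
  then obtain x where "(\<lambda>h. h c) ` base_lifts \<subseteq> {x}"
    using connected_uncountable[OF conn] by blast
  then have "h c = x" "(\<lambda>v\<in>V. 0) c = x"
    using h zero_in_base_lifts by blast+
  then show ?thesis using V by simp
qed

lemma point_inj_at:
  assumes h: "h \<in> lifts" "g \<in> lifts" and eq: "point h = point g" and c: "c \<in> V" "h c = g c"
  shows "h = g"
proof -
  obtain m where m: "\<And>v. v \<in> V \<Longrightarrow> g v = h v + of_int m"
    using point_eq_imp[OF h eq] by metis
  from m[OF c(1)] c(2) have "m = 0" by simp
  with m h show ?thesis
    by (intro extensionalityI[of _ V] lifts_ext) simp_all
qed

text \<open>On the compact slab of lifts that vanish at c the map \<open>point\<close> is injective,
  so within it \<open>base_lifts\<close> is the preimage of the closed set \<open>point\<close>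
  followed by its image, the component of f.\<close>

lemma compactin_base_lifts:
  assumes c: "(c, c) \<in> A\<^sup>+" shows "compactin lift_space base_lifts"
proof -
  have V: "c \<in> V" using trancl_verts c by blast
  let ?S = "{h \<in> lifts. h c \<in> {0..0}}" and ?Q = "point ` base_lifts"
  have "base_lifts = ?S \<inter> {h \<in> topspace lift_space. point h \<in> ?Q}"
  proof (intro equalityI subsetI)
    fix h assume "h \<in> base_lifts"
    then show "h \<in> ?S \<inter> {h \<in> topspace lift_space. point h \<in> ?Q}"
      using base_lifts_zero_on_cycle[OF _ c] base_lifts_subset unfolding topspace_lift_space by auto
  next
    fix h assume h: "h \<in> ?S \<inter> {h \<in> topspace lift_space. point h \<in> ?Q}"
    then obtain g where g: "g \<in> base_lifts" "point h = point g" by blast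
    have "h = g"
      by (rule point_inj_at[OF _ _ g(2) V])
         (use h g(1) base_lifts_subset base_lifts_zero_on_cycle[OF g(1) c] in auto)
    with g show "h \<in> base_lifts" by simp
  qed
  moreover have "compactin lift_space (?S \<inter> {h \<in> topspace lift_space. point h \<in> ?Q})"
    by (intro compact_Int_closedin compactin_slab V
        closedin_continuous_map_preimage[OF continuous_map_point closedin_Conn])
  ultimately show ?thesis by simp
qed

text \<open>A lift that maximizes the sum of its coordinates over the compact lattice is the
  greatest element: its join with a lift not below it would have a larger sum. The least element
  arises dually.\<close>

lemma base_lifts_max_min:
  assumes c: "(c, c) \<in> A\<^sup>+"
  obtains M m where "M \<in> base_lifts" "m \<in> base_lifts"
    "\<And>h v. h \<in> base_lifts \<Longrightarrow> v \<in> V \<Longrightarrow> m v \<le> h v \<and> h v \<le> M v"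
proof -
  define s where "s h = (\<Sum>v\<in>V. h v)" for h :: "'a \<Rightarrow> real"
  have "continuous_map lift_space euclideanreal s"
    unfolding s_def by (intro continuous_map_sum continuous_map_eval) auto
  then have "compact (s ` base_lifts)" "s ` base_lifts \<noteq> {}"
    using image_compactin[OF compactin_base_lifts[OF c], of euclideanreal s] zero_in_base_lifts
    by auto
  then obtain M m where M: "M \<in> base_lifts" "\<And>h. h \<in> base_lifts \<Longrightarrow> s h \<le> s M"
    and m: "m \<in> base_lifts" "\<And>h. h \<in> base_lifts \<Longrightarrow> s m \<le> s h"
    using compact_attains_sup[of "s ` base_lifts"] compact_attains_inf[of "s ` base_lifts"] by (metis imageE imageI)
  show ?thesis
  proof (rule that[OF M(1) m(1)])
    fix h v assume h: "h \<in> base_lifts" and v: "v \<in> V"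
    have "h v \<le> M v"
    proof (rule ccontr)
      assume "\<not> h v \<le> M v"
      then have "s M < s (join h M)"
        unfolding s_def using v by (intro sum_strict_mono_ex1) (auto simp: join_def intro!: bexI[of _ v])
      with M(2)[OF join_in_base_lifts[OF h M(1)]] show False by simp
    qed
    moreover have "m v \<le> h v"
    proof (rule ccontr)
      assume "\<not> m v \<le> h v"
      then have "s (meet h m) < s m"
        unfolding s_def using v by (intro sum_strict_mono_ex1) (auto simp: meet_def intro!: bexI[of _ v])
      with m(2)[OF meet_in_base_lifts[OF h m(1)]] show False by simp
    qed
    ultimately show "m v \<le> h v \<and> h v \<le> M v" by simp
  qed
qed

lemma contractible_Conn:
  assumes c: "(c, c) \<in> A\<^sup>+"
  shows "contractible_space (Conn X (hom_vertex G (cycle_graph k) f))"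
proof -
  let ?B = "subtopology lift_space base_lifts" and ?Q = "subtopology X (point ` base_lifts)"
  have top: "topspace ?B = base_lifts"
    using base_lifts_subset topspace_lift_space by auto
  obtain M m where M: "M \<in> base_lifts" "m \<in> base_lifts"
    and bounds: "\<And>h v. h \<in> base_lifts \<Longrightarrow> v \<in> V \<Longrightarrow> m v \<le> h v \<and> h v \<le> M v"
    using base_lifts_max_min[OF c] by metis
  have "path_connected_space ?B"
    using path_connectedin_path_component_of[of lift_space] unfolding base_lifts_def path_connectedin_def by blast
  then obtain p where p: "pathin ?B p" "p 0 = m" "p 1 = M"
    using M top unfolding path_connected_space_def by blast
  let ?I = "prod_topology (top_of_set {0..1::real}) ?B"
  \<comment> \<open>Joining with the least element m leaves h fixed, and joining with the greatest
    element M gives M.\<close>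
  define H where "H z = join (snd z) (p (fst z))" for z :: "real \<times> ('a \<Rightarrow> real)"
  have "continuous_map ?I lift_space (p \<circ> fst)"
    by (rule continuous_map_into_fulltopology)
       (rule continuous_map_compose[OF continuous_map_fst p(1)[unfolded pathin_def]])
  then have cp: "continuous_map ?I lift_space (\<lambda>z. p (fst z))" by (simp only: o_def)
  have "continuous_map ?I lift_space H"
    unfolding H_def by (rule continuous_map_join[OF continuous_map_into_fulltopology[OF continuous_map_snd] cp])
  moreover have "H \<in> topspace ?I \<rightarrow> base_lifts"
  proof
    fix z assume "z \<in> topspace ?I"
    then have z: "fst z \<in> {0..1}" "snd z \<in> base_lifts"
      unfolding topspace_prod_topology top by auto
    have "p (fst z) \<in> topspace ?B"
      using continuous_map_image_subset_topspace[OF p(1)[unfolded pathin_def]] z(1)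
      unfolding topspace_euclidean_subtopology by blast
    with z(2) show "H z \<in> base_lifts"
      unfolding top H_def by (intro join_in_base_lifts)
  qed
  ultimately have H: "continuous_map ?I ?B H" by (rule continuous_map_into_subtopology)
  have ext: "h \<in> extensional V" if "h \<in> base_lifts" for h
    using that base_lifts_subset lifts_ext by blast
  have "join h m = h" "join h M = M" if h: "h \<in> base_lifts" for h
  proof -
    have "join h m \<in> extensional V" "join h M \<in> extensional V" by (simp_all add: join_def)
    moreover have "join h m v = h v" "join h M v = M v" if "v \<in> V" for v
      using bounds[OF h that] that by (simp_all add: join_def)
    ultimately show "join h m = h" "join h M = M"
      by (auto intro: extensionalityI[of _ V] ext h M)
  qed
  then have "H (0, h) = id h" "H (1, h) = M" if "h \<in> topspace ?B" for h
    using that p(2,3) unfolding top by (simp_all add: H_def)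
  with H have "homotopic_with (\<lambda>x. True) ?B ?B id (\<lambda>x. M)"
    by (rule homotopic_with_TrueI)
  then have "contractible_space ?B" unfolding contractible_space_def by blast
  \<comment> \<open>A continuous bijection from a compact to a Hausdorff space; it is injective
    because all lifts in \<open>base_lifts\<close> agree at c.\<close>
  moreover have "homeomorphic_map ?B ?Q point"
  proof (rule continuous_imp_homeomorphic_map)
    show "continuous_map ?B ?Q point"
      by (intro continuous_map_into_subtopology continuous_map_from_subtopology continuous_map_point)
         (use top in blast)
    show "compact_space ?B" using compactin_base_lifts[OF c] by (simp add: compactin_subspace)
    show "Hausdorff_space ?Q" by (intro Hausdorff_space_subtopology Hausdorff_X)
    show "point ` topspace ?B = topspace ?Q"
      unfolding top using closedin_subset[OF closedin_Conn] by auto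
    show "inj_on point (topspace ?B)"
      unfolding top
    proof (rule inj_onI)
      fix h g assume hg: "h \<in> base_lifts" "g \<in> base_lifts" "point h = point g"
      show "h = g"
      proof (rule point_inj_at[OF _ _ hg(3) trancl_verts(1)[OF c]])
        show "h c = g c" by (simp add: base_lifts_zero_on_cycle[OF hg(1) c] base_lifts_zero_on_cycle[OF hg(2) c])
      qed (use hg base_lifts_subset in blast)+
    qed
  qed
  ultimately show ?thesis
    unfolding Conn_def Conn_eq
    using homeomorphic_space_contractibility homeomorphic_map_imp_homeomorphic_space by blast
qed

subsection \<open>Acyclic orientations\<close>

definition shift :: "int \<Rightarrow> ('a \<Rightarrow> real) \<Rightarrow> 'a \<Rightarrow> real" where
  "shift m h = (\<lambda>v\<in>V. h v + of_int m)"

lemma shift_in_lifts: "h \<in> lifts \<Longrightarrow> shift m h \<in> lifts"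
  using arc_verts by (auto simp: lifts_def shift_def intro!: stair_add_of_int)

lemma join_shift: "join (shift m h) (shift m g) = shift m (join h g)"
  by (auto simp: join_def shift_def max_def)

lemma point_shift: "int k dvd 2 * m \<Longrightarrow> point (shift m h) = point h"
  unfolding shift_def by (rule point_add_of_int)

lemma point_eq_imp_shift:
  assumes "h \<in> lifts" "h' \<in> lifts" "point h = point h'"
  obtains m where "int k dvd 2 * m" "h' = shift m h"
proof -
  obtain m where m: "int k dvd 2 * m" "\<And>v. v \<in> V \<Longrightarrow> h' v = h v + of_int m"
    using point_eq_imp[OF assms] by metis
  have "h' = shift m h"
    by (rule extensionalityI[of _ V]) (use assms(2) lifts_ext m(2) in \<open>simp_all add: shift_def\<close>)
  with m(1) show ?thesis by (rule that)
qed

text \<open>A substitute for a topological enumeration: for acyclic orientations it increases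
  strictly along arcs and stays below \<open>card V\<close>, while nonadjacent vertices may share a
  value.\<close>

definition depth :: "'a \<Rightarrow> nat" where
  "depth v = card {u. (u, v) \<in> A\<^sup>+}"

text \<open>With n = \<open>card V\<close>, vertex v climbs from j to j + 1 while n * t runs from n
  * j + \<open>depth v\<close> to n * j + \<open>depth v\<close> + 1. In one unit of t every vertex
  climbs once, in order of depth.\<close>

definition line :: "real \<Rightarrow> 'a \<Rightarrow> real" where
  "line t = (\<lambda>v\<in>V. step_fun (card V) (real (card V) * t - real (depth v)))"

text \<open>P is k / 2 for even k and k for odd k; its multiples are the translations that preserve
  \<open>point\<close>.\<close>

lemma period_exists: obtains P :: nat where "P > 0" "\<And>m. int k dvd 2 * m \<longleftrightarrow> int P dvd m"
proof (cases "even k")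
  case True
  then obtain P where P: "k = 2 * P" by blast
  show ?thesis by (rule that[of P]) (use P k in auto)
next
  case False
  then have "coprime (int k) 2" by simp
  then show ?thesis
    using that[of k] k by (auto simp: coprime_dvd_mult_right_iff)
qed

end

section \<open>A translation-equivariant line of lifts\<close>

locale acyclic_cycle_hom = cycle_hom +
  assumes acyclic: "\<And>c. (c, c) \<notin> A\<^sup>+"
begin

lemma depth_less:
  assumes "v \<in> V" shows "depth v < card V"
proof -
  have "{u. (u, v) \<in> A\<^sup>+} \<subseteq> V - {v}"
    using acyclic trancl_verts by blast
  then have "depth v \<le> card (V - {v})"
    unfolding depth_def by (intro card_mono) auto
  then show ?thesis
    using assms card_Diff1_less[of V v] by auto
qed

text \<open>Every ancestor of u is one of v, and u is an ancestor of v but, by acyclicity, not of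
  itself.\<close>

lemma depth_arc:
  assumes "(u, v) \<in> A" shows "depth u < depth v"
  unfolding depth_def
proof (rule psubset_card_mono)
  have "{u. (u, v) \<in> A\<^sup>+} \<subseteq> V" using trancl_verts by blast
  then show "finite {u. (u, v) \<in> A\<^sup>+}" by (rule finite_subset) auto
  show "{w. (w, u) \<in> A\<^sup>+} \<subset> {w. (w, v) \<in> A\<^sup>+}"
    using assms acyclic[of u] by (auto intro: trancl.trancl_into_trancl)
qed

lemma card_V_pos: "card V > 0"
  using card_verts by linarith

lemma line_in_lifts: "line t \<in> lifts"
proof -
  have "stair (line t u) (line t v)" if uv: "(u, v) \<in> A" for u v
  proof -
    have V: "u \<in> V" "v \<in> V" using uv arc_verts by auto
    let ?n = "card V" and ?d = "depth v - depth u"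
    have "stair (step_fun ?n (real ?n * t - real (depth u))) (step_fun ?n (real ?n * t - real (depth u) - real ?d))"
      by (rule stair_step_fun) (use depth_arc[OF uv] depth_less[OF V(2)] in auto)
    moreover have "real ?n * t - real (depth u) - real ?d = real ?n * t - real (depth v)"
      using depth_arc[OF uv] by (simp add: of_nat_diff)
    ultimately show ?thesis using V by (simp add: line_def)
  qed
  moreover have "line t \<in> V \<rightarrow>\<^sub>E UNIV" by (simp add: line_def)
  ultimately show ?thesis unfolding lifts_def by blast
qed

lemma line_shift: "line (t + of_int m) = shift m (line t)"
proof -
  have "real (card V) * (t + of_int m) - real (depth v) =
      (real (card V) * t - real (depth v)) + of_int (m * int (card V))" for v
    by (simp add: algebra_simps)
  then show ?thesis
    unfolding line_def shift_def by (intro restrict_ext) (simp only: step_fun_add[OF card_V_pos] restrict_apply' if_True)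
qed

lemma line_bounds:
  assumes "v \<in> V" shows "t - 1 \<le> line t v" "line t v \<le> t + 1"
proof -
  let ?n = "real (card V)"
  have n: "0 < ?n" using card_V_pos by simp
  have r: "real (depth v) \<le> ?n" using depth_less[OF assms] by simp
  have "?n * t - real (depth v) \<le> ?n * line t v" "?n * line t v \<le> ?n * t - real (depth v) + ?n"
    using step_fun_bounds[OF card_V_pos] assms by (simp_all add: line_def)
  then have "?n * (t - 1) \<le> ?n * line t v" "?n * line t v \<le> ?n * (t + 1)"
    using r by (simp_all add: algebra_simps)
  then show "t - 1 \<le> line t v" "line t v \<le> t + 1"
    using n by simp_all
qed

lemma continuous_map_line:
  assumes "continuous_map Y euclideanreal g"
  shows "continuous_map Y lift_space (\<lambda>y. line (g y))"
proof (rule continuous_map_lift_space)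
  fix v assume v: "v \<in> V"
  have "continuous_on UNIV (\<lambda>t. step_fun (card V) (real (card V) * t - real (depth v)))"
    unfolding step_fun_def
    by (intro continuous_on_compose2[OF continuous_on_interp] continuous_intros) auto
  then have "continuous_map euclideanreal euclideanreal (\<lambda>t. line t v)"
    using v by (simp add: line_def)
  from continuous_map_compose[OF assms this]
  show "continuous_map Y euclideanreal (\<lambda>y. line (g y) v)" by (simp add: o_def)
qed (rule line_in_lifts)

section \<open>Deformation of the space of lifts onto the line\<close>

definition base :: 'a where "base = (SOME v. v \<in> V)"

lemma base: "base \<in> V"
  unfolding base_def using card_V_pos by (intro someI_ex[of "\<lambda>v. v \<in> V"]) (auto simp: card_gt_0_iff)

text \<open>The added 1 absorbs the distance of at most 1 between \<open>line t v\<close> and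
  t.\<close>

definition radius :: real where
  "radius = (SOME D. \<forall>h \<in> lifts. \<forall>v \<in> V. \<bar>h base - h v\<bar> \<le> D) + 1"

lemma radius:
  assumes "h \<in> lifts" "v \<in> V" shows "\<bar>h base - h v\<bar> \<le> radius - 1"
proof -
  obtain D where "\<And>h u v. h \<in> lifts \<Longrightarrow> u \<in> V \<Longrightarrow> v \<in> V \<Longrightarrow> \<bar>h u - h v\<bar> \<le> D"
    using lifts_bounded by blast
  then have "\<exists>D. \<forall>h \<in> lifts. \<forall>v \<in> V. \<bar>h base - h v\<bar> \<le> D"
    using base by blast
  from someI_ex[OF this] assms show ?thesis by (simp add: radius_def)
qed

text \<open>The line passes below \<open>h\<close> at parameter \<open>h base - radius\<close> and above \<open>h\<close> at \<open>h base + radius\<close>.\<close>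

definition push :: "real \<times> ('a \<Rightarrow> real) \<Rightarrow> 'a \<Rightarrow> real" where
  "push z = join (snd z) (line (snd z base + (1 - 2 * fst z) * radius))"

lemma push_0:
  assumes h: "h \<in> lifts" shows "push (0, h) = line (h base + radius)"
proof (rule extensionalityI[of _ V])
  show "push (0, h) v = line (h base + radius) v" if "v \<in> V" for v
    using radius[OF h that] line_bounds(1)[OF that, of "h base + radius"] that
    by (simp add: push_def join_def abs_le_iff)
qed (simp_all add: push_def join_def line_def)

lemma push_1:
  assumes h: "h \<in> lifts" shows "push (1, h) = h"
proof (rule extensionalityI[of _ V])
  show "push (1, h) v = h v" if "v \<in> V" for v
    using radius[OF h that] line_bounds(2)[OF that, of "h base - radius"] that
    by (simp add: push_def join_def abs_le_iff)
qed (use h lifts_ext in \<open>simp_all add: push_def join_def\<close>)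

lemma push_shift: "push (s, shift m h) = shift m (push (s, h))"
proof -
  have "shift m h base + (1 - 2 * s) * radius = h base + (1 - 2 * s) * radius + of_int m"
    using base by (simp add: shift_def)
  then show ?thesis by (simp only: push_def fst_conv snd_conv line_shift join_shift)
qed

lemma continuous_map_push:
  "continuous_map (prod_topology (top_of_set {0..1}) lift_space) lift_space push"
proof -
  let ?I = "prod_topology (top_of_set {0..1::real}) lift_space"
  have s: "continuous_map ?I euclideanreal fst"
    by (rule continuous_map_into_fulltopology[OF continuous_map_fst])
  have h: "continuous_map ?I euclideanreal (\<lambda>z. snd z base)"
    by (rule continuous_map_coord[OF continuous_map_snd base])
  have "continuous_map ?I euclideanreal (\<lambda>z. snd z base + (1 - 2 * fst z) * radius)"
    by (intro continuous_map_add continuous_map_real_mult continuous_map_diff s h continuous_map_canonical_const; simp)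
  from continuous_map_join[OF continuous_map_snd continuous_map_line[OF this]]
  show ?thesis unfolding push_def .
qed

text \<open>\<open>push\<close> joins every lift to a point of the line, and the line is itself a
  path, so the space of lifts is path connected.\<close>

lemma base_lifts_eq: "base_lifts = lifts"
proof
  have line: "path_component_of lift_space (line a) (line b)" for a b
  proof -
    have "pathin lift_space (\<lambda>t. line (a + t * (b - a)))"
      unfolding pathin_def by (rule continuous_map_line) (auto intro!: continuous_intros)
    then show ?thesis
      unfolding path_component_of_def by (intro exI[of _ "\<lambda>t. line (a + t * (b - a))"]) simp
  qed
  have "path_component_of lift_space (line (h base + radius)) h" if h: "h \<in> lifts" for h
  proof -
    have "continuous_map (top_of_set {0..1}) (prod_topology (top_of_set {0..1::real}) lift_space) (\<lambda>s. (s, h))"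
      using h unfolding continuous_map_pairwise o_def fst_conv snd_conv continuous_map_const topspace_lift_space
      by (simp add: continuous_map_id[unfolded id_def])
    from continuous_map_compose[OF this continuous_map_push]
    have "pathin lift_space (\<lambda>s. push (s, h))"
      by (simp add: pathin_def o_def)
    then show ?thesis
      unfolding path_component_of_def using push_0[OF h] push_1[OF h]
      by (intro exI[of _ "\<lambda>s. push (s, h)"]) simp
  qed
  note path = this
  show "lifts \<subseteq> base_lifts"
  proof
    fix h assume h: "h \<in> lifts"
    have "path_component_of lift_space (\<lambda>v\<in>V. 0) h"
      by (rule path_component_of_trans[OF path_component_of_sym[OF path[OF zero_in_lifts]]
            path_component_of_trans[OF line path[OF h]]])
    then show "h \<in> base_lifts" by (simp add: base_lifts_def)
  qed
qed (rule base_lifts_subset)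

text \<open>Lifts go to the real line by their height at \<open>base\<close>, and t goes back to
  \<open>line (t + radius)\<close>. One composite is deformed to the identity by
  \<open>push\<close>, the other by the linear homotopy J.\<close>

lemma Conn_homotopy_equivalent_circle:
  "Conn X (hom_vertex G (cycle_graph k) f) homotopy_equivalent_space top_of_set (sphere (0::complex) 1)"
proof -
  obtain P :: nat where P: "P > 0" "\<And>m. int k dvd 2 * m \<longleftrightarrow> int P dvd m"
    using period_exists by blast
  have P0: "real P > 0" using P(1) by simp
  let ?Y = "subtopology X (point ` lifts)"
  define c where "c = (\<lambda>t. cis (2 * pi * t / P))"
  have c_eq: "c x = c y \<longleftrightarrow> (\<exists>n::int. x = y + real P * of_int n)" for x y
    unfolding c_def by (rule cis_period_eq_iff[OF P0])
  have point_shift_P: "point (shift (int P * n) h) = point h" for n h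
    by (rule point_shift) (simp add: P(2))
  have point_eq: "\<exists>n. h' = shift (int P * n) h" if "h \<in> lifts" "h' \<in> lifts" "point h = point h'" for h h'
    using point_eq_imp_shift[OF that] P(2) by (metis dvdE)
  have top_Y: "topspace ?Y = point ` lifts"
    using closedin_subset[OF closedin_Conn] unfolding base_lifts_eq by auto
  \<comment> \<open>J commutes with translations by multiples of P because the height of the line at
    \<open>base\<close> does.\<close>
  define J where "J = (\<lambda>z. (1 - fst z) * line (snd z + radius) base + fst z * snd z)"
  have lb: "continuous_map euclideanreal euclideanreal (\<lambda>t. line (t + radius) base)"
    by (rule continuous_map_coord[OF _ base]) (rule continuous_map_line, auto intro!: continuous_intros)
  let ?J = "prod_topology (top_of_set {0..1::real}) euclideanreal"
  have s: "continuous_map ?J euclideanreal fst"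
    by (rule continuous_map_into_fulltopology[OF continuous_map_fst])
  have t: "continuous_map ?J euclideanreal (\<lambda>z. line (snd z + radius) base)"
    using continuous_map_compose[OF continuous_map_snd lb] unfolding o_def .
  have "?Y homotopy_equivalent_space top_of_set (sphere (0::complex) 1)"
  proof (rule homotopy_equivalent_quotients)
    show "continuous_map lift_space ?Y point"
      by (intro continuous_map_into_subtopology continuous_map_point) (use topspace_lift_space in auto)
    show "compactin lift_space {h \<in> lifts. h base \<in> {0..real P}}"
      by (rule compactin_slab[OF base])
    show "point ` {h \<in> lifts. h base \<in> {0..real P}} = topspace ?Y"
      unfolding top_Y
    proof
      show "point ` lifts \<subseteq> point ` {h \<in> lifts. h base \<in> {0..real P}}"
      proof
        fix x assume "x \<in> point ` lifts"
        then obtain h where h: "h \<in> lifts" "x = point h" by blast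
        \<comment> \<open>Translating by this multiple of P brings the height at \<open>base\<close>
          into [0, P], so the slab over this interval already represents every point of the
          component.\<close>
        define n where "n = - \<lfloor>h base / P\<rfloor>"
        have "shift (int P * n) h base = h base - P * of_int \<lfloor>h base / P\<rfloor>"
          using base by (simp add: shift_def n_def)
        also have "\<dots> = P * (h base / P - of_int \<lfloor>h base / P\<rfloor>)"
          using P0 by (simp add: field_simps)
        finally have eq: "shift (int P * n) h base = P * frac (h base / P)"
          by (simp add: frac_def)
        have "0 \<le> frac (h base / P)" "frac (h base / P) \<le> 1"
          using frac_lt_1[of "h base / P"] by auto
        then have "shift (int P * n) h base \<in> {0..real P}"
          unfolding eq using P0 by (auto simp: mult_left_le)
        then show "x \<in> point ` {h \<in> lifts. h base \<in> {0..real P}}"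
          using h shift_in_lifts[OF h(1)] point_shift_P[of n h] by (intro image_eqI[of _ _ "shift (int P * n) h"]) auto
      qed
    qed auto
    show "Hausdorff_space ?Y" by (intro Hausdorff_space_subtopology Hausdorff_X)
    show "continuous_map euclideanreal (top_of_set (sphere 0 1)) c"
      unfolding c_def using P0 by (auto intro!: continuous_intros continuous_map_into_subtopology)
    show "compactin euclideanreal {0..real P}" by simp
    show "c ` {0..real P} = topspace (top_of_set (sphere 0 1))"
      unfolding c_def using cis_period_image[OF P0] by simp
    show "Hausdorff_space (top_of_set (sphere (0::complex) 1))"
      by (intro Hausdorff_space_subtopology) simp
    show "continuous_map lift_space euclideanreal (\<lambda>h. h base)"
      by (rule continuous_map_eval[OF base])
    show "c (h base) = c (h' base)"
      if hh': "h \<in> topspace lift_space" "h' \<in> topspace lift_space" "point h = point h'" for h h'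
    proof -
      obtain n where "h' = shift (int P * n) h"
        using point_eq hh' unfolding topspace_lift_space by blast
      then have "h' base = h base + real P * of_int n" using base by (simp add: shift_def)
      then have "c (h' base) = c (h base)" unfolding c_eq by blast
      then show ?thesis by simp
    qed
    show "continuous_map euclideanreal lift_space (\<lambda>t. line (t + radius))"
      by (rule continuous_map_line) (auto intro!: continuous_intros)
    have line_P: "line (y + real P * of_int n) = shift (int P * n) (line y)" for y n
      using line_shift[of y "int P * n"] by simp
    show "point (line (x + radius)) = point (line (y + radius))" if "c x = c y" for x y
    proof -
      obtain n :: int where "x = y + real P * of_int n" using \<open>c x = c y\<close> c_eq by blast
      then have "line (x + radius) = shift (int P * n) (line (y + radius))"
        using line_P[of "y + radius" n] by (simp add: algebra_simps)
      then show ?thesis by (simp only: point_shift_P)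
    qed
    show "continuous_map (prod_topology (top_of_set {0..1}) lift_space) lift_space push"
      by (rule continuous_map_push)
    show "point (push (s, h)) = point (push (s, h'))"
      if hh': "h \<in> topspace lift_space" "h' \<in> topspace lift_space" "point h = point h'" for s h h'
    proof -
      obtain n where "h' = shift (int P * n) h"
        using point_eq hh' unfolding topspace_lift_space by blast
      then show ?thesis by (simp only: push_shift point_shift_P)
    qed
    show "push (0, h) = line (h base + radius)" "push (1, h) = h" if "h \<in> topspace lift_space" for h
      using that push_0 push_1 unfolding topspace_lift_space by blast+
    show "continuous_map ?J euclideanreal J"
      unfolding J_def
      by (intro continuous_map_add continuous_map_real_mult continuous_map_diff s t
          continuous_map_canonical_const continuous_map_snd; simp)
    show "c (J (s, x)) = c (J (s, y))" if "c x = c y" for s x y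
    proof -
      obtain n :: int where n: "x = y + real P * of_int n" using \<open>c x = c y\<close> c_eq by blast
      have "line (x + radius) base = line (y + radius) base + real P * of_int n"
        using line_P[of "y + radius" n] base n by (simp add: algebra_simps shift_def)
      then have "J (s, x) = J (s, y) + real P * of_int n"
        unfolding J_def n by (simp add: algebra_simps)
      then show ?thesis unfolding c_eq by blast
    qed
    show "J (0, x) = line (x + radius) base" "J (1, x) = x" for x
      by (simp_all add: J_def)
  qed
  then show ?thesis
    unfolding Conn_def Conn_eq base_lifts_eq .
qed

end

theorem theorem5p1:
  fixes G :: "'a pair_pre_digraph" and k :: nat and f :: "'a \<Rightarrow> int"
  assumes "pair_graph G"
    and "Digraph_Component.connected (with_proj G)"
    and "card (pverts G) \<ge> 2"
    and "k \<ge> 3" and "k \<noteq> 4"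
    and "f \<in> graph_homs G (cycle_graph k)"
  shows "(has_directed_cycle (hom_orientation k G f) \<longrightarrow>
            contractible_space
              (Conn (hom_complex G (cycle_graph k)) (hom_vertex G (cycle_graph k) f))) \<and>
         (\<not> has_directed_cycle (hom_orientation k G f) \<longrightarrow>
            Conn (hom_complex G (cycle_graph k)) (hom_vertex G (cycle_graph k) f)
              homotopy_equivalent_space top_of_set (sphere (0::complex) 1))"
proof -
  interpret cycle_hom G k f
    using assms by (rule cycle_hom.intro)
  have "Conn X (hom_vertex G (cycle_graph k) f) homotopy_equivalent_space top_of_set (sphere (0::complex) 1)"
    if "\<not> (\<exists>c. (c, c) \<in> A\<^sup>+)"
  proof -
    interpret acyclic_cycle_hom G k f
      using that by unfold_locales blast
    show ?thesis by (rule Conn_homotopy_equivalent_circle)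
  qed
  then show ?thesis
    unfolding has_directed_cycle_iff_trancl using contractible_Conn by blast
qed

end
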